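(* Let $\mathfrak g$ be a finite-dimensional real Lie algebra and $\mathfrak i\lhd\mathfrak g$ an ideal, with canonical projection $\pi_{\mathfrak g/\mathfrak i}\colon\mathfrak g\to\mathfrak g/\mathfrak i$. The map $$\Pi\colon\big(C^\bullet(\mathfrak g;\mathfrak g/\mathfrak i)[1],-\delta_{\pi_{\mathfrak g/\mathfrak i}}\big)\to\big(C^\bullet(\mathfrak g;\mathfrak i^*\otimes\mathfrak g/\mathfrak i),\delta^{\mathrm{Hom}}_{\mathfrak g\rhd\mathfrak i}\big),\qquad C^{k+1}(\mathfrak g;\mathfrak g/\mathfrak i)\ni\phi\mapsto(-1)^{k+1}\phi|_{(\wedge^k\mathfrak g)\wedge\mathfrak i}\in C^k(\mathfrak g;\mathfrak i^*\otimes\mathfrak g/\mathfrak i)$$ for all $k\ge0$, is a (natural) cochain map from the deformation complex of the Lie algebra morphism $\pi_{\mathfrak g/\mathfrak i}$ to the deformation complex of the ideal $\mathfrak i\lhd\mathfrak g$. In addition, $\Pi$ sends deformation cocycles (of the morphism $\pi_{\mathfrak g/\mathfrak i}$) to deformation cocycles (of the ideal $\mathfrak i$).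
   Context: $C^p(\mathfrak g;V)=\wedge^p\mathfrak g^*\otimes V$. For $\bar x=\pi_{\mathfrak g/\mathfrak i}(x)$: • $\delta_{\pi_{\mathfrak g/\mathfrak i}}$ is the Chevalley–Eilenberg differential on $C^\bullet(\mathfrak g;\mathfrak g/\mathfrak i)$ for the representation $x\mapsto[\bar x,\cdot]$ of $\mathfrak g$ on $\mathfrak g/\mathfrak i$. • $C^p(\mathfrak g;\mathfrak i^*\otimes\mathfrak g/\mathfrak i)=\wedge^p\mathfrak g^*\otimes\mathfrak i^*\otimes\mathfrak g/\mathfrak i$, and $\delta^{\mathrm{Hom}}_{\mathfrak g\rhd\mathfrak i}$ is the Chevalley–Eilenberg differential for the representation $\mathrm{ad}^{\mathrm{Hom}}_x(\phi)(u)=[\bar x,\phi(u)]-\phi([x,u])$ of $\mathfrak g$ on $\mathrm{Hom}(\mathfrak i,\mathfrak g/\mathfrak i)$. The Chevalley–Eilenberg differential for a representation $r$ on $V$ is $\delta\omega(x_1,\dots,x_{p+1})=\sum_i(-1)^{i+1}r(x_i)(\omega(x_1,\dots,\widehat{x_i},\dots,x_{p+1}))+\sum_{i<j}(-1)^{i+j}\omega([x_i,x_j],x_1,\dots,\widehat{x_i},\dots,\widehat{x_j},\dots,x_{p+1})$. Shift convention: $A^\bullet[1]$ of a complex $(A^\bullet,d)$ in degrees $\ge0$ has differential $-d$ and is truncated to non-negative degrees, i.e. $A^\bullet[1]$ has $A^{k+1}$ in degree $k$ for $k\ge0$ only. $\phi|_{(\wedge^k\mathfrak g)\wedge\mathfrak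 i}$ is the element $(x_1,\dots,x_k,u)\mapsto\phi(x_1,\dots,x_k,u)$, $x_j\in\mathfrak g$, $u\in\mathfrak i$, of $\wedge^k\mathfrak g^*\otimes\mathfrak i^*\otimes\mathfrak g/\mathfrak i$. A deformation cocycle of the morphism $\pi_{\mathfrak g/\mathfrak i}$ is an element $\frac{d}{dt}|_{t=0}\pi^t\in C^1(\mathfrak g;\mathfrak g/\mathfrak i)$, where $t\mapsto\pi^t\in\mathfrak g^*\otimes\mathfrak g/\mathfrak i$ is a smooth curve (defined on an interval around $0$) of Lie algebra morphisms with $\pi^0=\pi_{\mathfrak g/\mathfrak i}$. A deformation cocycle of the ideal $\mathfrak i$ (of dimension $d$) is an element $\frac{d}{dt}|_{t=0}\mathfrak i_t\in T_{\mathfrak i}\mathrm{Gr}_d(\mathfrak g)\simeq\mathfrak i^*\otimes\mathfrak g/\mathfrak i=C^0(\mathfrak g;\mathfrak i^*\otimes\mathfrak g/\mathfrak i)$ for a smooth curve $t\mapsto\mathfrak i_t\in\mathrm{Gr}_d(\mathfrak g)$ of ideals of $\mathfrak g$ with $\mathfrak i_0=\mathfrak i$; only the germ of the curve at $t=0$ matters. The identification: if $\mathfrak i_t=\mathrm{graph}(\phi(t))$ with $\phi(t)\in\mathrm{Hom}(\mathfrak i,\mathfrak i^c)$ for a complement $\mathfrak i^c$ of $\mathfrak i$, then $\frac{d}{dt}|_{t=0}\mathfrak i_t=\pi_{\mathfrak g/\mathfrak i}\circ\dot\phi(0)$. *)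

theory Defs
  imports "HOL-Analysis.Analysis" "HOL-Algebra.Module"
begin

section \<open>Real vector spaces given by a carrier\<close>

text \<open>
  The Lie algebra is a type of class \<open>real_vector\<close>. The spaces derived from it (quotients,
  spaces of linear maps, spaces of cochains) depend on terms, so they are \<open>module\<close> records over
  the reals, whose ring multiplication and unit carry no meaning. Functions in a carrier are
  extensional, so that equality in the carrier is equality of functions.
\<close>

definition subspace_module :: "'v::real_vector set \<Rightarrow> (real, 'v) module" where
  "subspace_module S =
     \<lparr>carrier = S, mult = undefined, one = undefined, zero = 0, add = (+), smult = (*\<^sub>R)\<rparr>"

definition lin_maps :: "(real, 'v) module \<Rightarrow> (real, 'w) module \<Rightarrow> ('v \<Rightarrow> 'w) set" where
  "lin_maps V W = {f \<in> carrier V \<rightarrow> carrier W.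
     (\<forall>x\<in>carrier V. \<forall>y\<in>carrier V. f (x \<oplus>\<^bsub>V\<^esub> y) = f x \<oplus>\<^bsub>W\<^esub> f y) \<and>
     (\<forall>c. \<forall>x\<in>carrier V. f (c \<odot>\<^bsub>V\<^esub> x) = c \<odot>\<^bsub>W\<^esub> f x)}"

definition hom_space :: "(real, 'v) module \<Rightarrow> (real, 'w) module \<Rightarrow> (real, 'v \<Rightarrow> 'w) module" where
  "hom_space V W =
     \<lparr>carrier = lin_maps V W \<inter> extensional (carrier V), mult = undefined, one = undefined,
      zero = (\<lambda>x\<in>carrier V. \<zero>\<^bsub>W\<^esub>),
      add = (\<lambda>f g. \<lambda>x\<in>carrier V. f x \<oplus>\<^bsub>W\<^esub> g x),
      smult = (\<lambda>c f. \<lambda>x\<in>carrier V. c \<odot>\<^bsub>W\<^esub> f x)\<rparr>"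


section \<open>Lie algebras, ideals and quotients\<close>

definition finite_dimensional :: "'g::real_vector itself \<Rightarrow> bool" where
  "finite_dimensional _ \<longleftrightarrow> (\<exists>B::'g set. finite B \<and> span B = UNIV)"

definition lie_algebra :: "('g::real_vector \<Rightarrow> 'g \<Rightarrow> 'g) \<Rightarrow> bool" where
  "lie_algebra br \<longleftrightarrow> bilinear br \<and> (\<forall>x. br x x = 0) \<and>
     (\<forall>x y z. br x (br y z) + br y (br z x) + br z (br x y) = 0)"

definition lie_ideal :: "('g::real_vector \<Rightarrow> 'g \<Rightarrow> 'g) \<Rightarrow> 'g set \<Rightarrow> bool" where
  "lie_ideal br I \<longleftrightarrow> subspace I \<and> (\<forall>x. \<forall>u\<in>I. br x u \<in> I)"

definition quot_proj :: "'g::real_vector set \<Rightarrow> 'g \<Rightarrow> 'g set" where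
  "quot_proj I x = {x + u |u. u \<in> I}"

text \<open>Adding \<open>I\<close> in the scalar multiplication matters only for \<open>c = 0\<close>.\<close>

definition quot_space :: "'g::real_vector set \<Rightarrow> (real, 'g set) module" where
  "quot_space I =
     \<lparr>carrier = range (quot_proj I), mult = undefined, one = undefined,
      zero = I,
      add = (\<lambda>A B. {a + b |a b. a \<in> A \<and> b \<in> B}),
      smult = (\<lambda>c A. {c *\<^sub>R a + u |a u. a \<in> A \<and> u \<in> I})\<rparr>"

definition quot_bracket ::
    "('g::real_vector \<Rightarrow> 'g \<Rightarrow> 'g) \<Rightarrow> 'g set \<Rightarrow> 'g set \<Rightarrow> 'g set \<Rightarrow> 'g set" where
  "quot_bracket br I A B = {br a b + u |a b u. a \<in> A \<and> b \<in> B \<and> u \<in> I}"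


section \<open>Chevalley--Eilenberg cochains\<close>

text \<open>
  \<open>\<wedge>\<^sup>p g\<^sup>* \<otimes> V\<close> as the space of alternating \<open>p\<close>-linear maps from \<open>g\<close> to \<open>V\<close>, the \<open>p\<close> arguments
  being a list of length \<open>p\<close>.
\<close>

definition cochains :: "nat \<Rightarrow> (real, 'v) module \<Rightarrow> (real, 'g::real_vector list \<Rightarrow> 'v) module" where
  "cochains p V =
     \<lparr>carrier = {\<omega> \<in> {xs. length xs = p} \<rightarrow>\<^sub>E carrier V.
        (\<forall>xs k. length xs = p \<and> k < p \<longrightarrow>
           (\<lambda>x. \<omega> (xs[k := x])) \<in> lin_maps (subspace_module UNIV) V) \<and>
        (\<forall>xs i j. length xs = p \<and> i < j \<and> j < p \<and> xs ! i = xs ! j \<longrightarrow> \<omega> xs = \<zero>\<^bsub>V\<^esub>)},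
      mult = undefined, one = undefined,
      zero = (\<lambda>xs\<in>{xs. length xs = p}. \<zero>\<^bsub>V\<^esub>),
      add = (\<lambda>\<omega> \<eta>. \<lambda>xs\<in>{xs. length xs = p}. \<omega> xs \<oplus>\<^bsub>V\<^esub> \<eta> xs),
      smult = (\<lambda>c \<omega>. \<lambda>xs\<in>{xs. length xs = p}. c \<odot>\<^bsub>V\<^esub> \<omega> xs)\<rparr>"

text \<open>
  The differential from degree \<open>p\<close> to degree \<open>p + 1\<close> for \<open>r\<close>. Positions are counted from \<open>0\<close>, so
  the sign \<open>(-1)\<^sup>i\<^sup>+\<^sup>1\<close> of the usual formula becomes \<open>(-1)\<^sup>i\<close>, and \<open>(-1)\<^sup>i\<^sup>+\<^sup>j\<close> is unchanged.
  \<open>nths xs (- A)\<close> is \<open>xs\<close> with the positions in \<open>A\<close> left out.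
\<close>

definition ce_diff ::
    "('g::real_vector \<Rightarrow> 'g \<Rightarrow> 'g) \<Rightarrow> (real, 'v) module \<Rightarrow> ('g \<Rightarrow> 'v \<Rightarrow> 'v) \<Rightarrow>
     nat \<Rightarrow> ('g list \<Rightarrow> 'v) \<Rightarrow> ('g list \<Rightarrow> 'v)" where
  "ce_diff br V r p \<omega> = (\<lambda>xs\<in>{xs. length xs = Suc p}.
     (\<Oplus>\<^bsub>V\<^esub>i\<in>{..p}. (-1) ^ i \<odot>\<^bsub>V\<^esub> r (xs ! i) (\<omega> (nths xs (- {i})))) \<oplus>\<^bsub>V\<^esub>
     finsum V (\<lambda>(i, j). (-1) ^ (i + j) \<odot>\<^bsub>V\<^esub> \<omega> (br (xs ! i) (xs ! j) # nths xs (- {i, j})))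
       {(i, j). i < j \<and> j \<le> p})"

text \<open>A complex in degrees \<open>\<ge> 0\<close>: its spaces and its differentials.\<close>

type_synonym 'a complex_data = "(nat \<Rightarrow> (real, 'a) module) \<times> (nat \<Rightarrow> 'a \<Rightarrow> 'a)"

definition ce_complex ::
    "('g::real_vector \<Rightarrow> 'g \<Rightarrow> 'g) \<Rightarrow> (real, 'v) module \<Rightarrow> ('g \<Rightarrow> 'v \<Rightarrow> 'v) \<Rightarrow>
     ('g list \<Rightarrow> 'v) complex_data" where
  "ce_complex br V r = ((\<lambda>p. cochains p V), ce_diff br V r)"

definition shift_complex :: "'a complex_data \<Rightarrow> 'a complex_data" where
  "shift_complex K = ((\<lambda>k. fst K (k + 1)), (\<lambda>k a. (-1) \<odot>\<^bsub>fst K (k + 2)\<^esub> snd K (k + 1) a))"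

definition cochain_map :: "'a complex_data \<Rightarrow> 'b complex_data \<Rightarrow> (nat \<Rightarrow> 'a \<Rightarrow> 'b) \<Rightarrow> bool" where
  "cochain_map K L f \<longleftrightarrow> (\<forall>k. f k \<in> lin_maps (fst K k) (fst L k) \<and>
     (\<forall>a\<in>carrier (fst K k). f (k + 1) (snd K k a) = snd L k (f k a)))"


section \<open>The two deformation complexes and the map between them\<close>

definition quot_rep ::
    "('g::real_vector \<Rightarrow> 'g \<Rightarrow> 'g) \<Rightarrow> 'g set \<Rightarrow> 'g \<Rightarrow> 'g set \<Rightarrow> 'g set" where
  "quot_rep br I x = quot_bracket br I (quot_proj I x)"

definition ideal_hom :: "'g::real_vector set \<Rightarrow> (real, 'g \<Rightarrow> 'g set) module" where
  "ideal_hom I = hom_space (subspace_module I) (quot_space I)"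

definition hom_rep ::
    "('g::real_vector \<Rightarrow> 'g \<Rightarrow> 'g) \<Rightarrow> 'g set \<Rightarrow> 'g \<Rightarrow> ('g \<Rightarrow> 'g set) \<Rightarrow> ('g \<Rightarrow> 'g set)" where
  "hom_rep br I x \<phi> =
     (\<lambda>u\<in>I. quot_bracket br I (quot_proj I x) (\<phi> u) \<ominus>\<^bsub>quot_space I\<^esub> \<phi> (br x u))"

definition morphism_complex ::
    "('g::real_vector \<Rightarrow> 'g \<Rightarrow> 'g) \<Rightarrow> 'g set \<Rightarrow> ('g list \<Rightarrow> 'g set) complex_data" where
  "morphism_complex br I = shift_complex (ce_complex br (quot_space I) (quot_rep br I))"

definition ideal_complex ::
    "('g::real_vector \<Rightarrow> 'g \<Rightarrow> 'g) \<Rightarrow> 'g set \<Rightarrow> ('g list \<Rightarrow> 'g \<Rightarrow> 'g set) complex_data" where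
  "ideal_complex br I = ce_complex br (ideal_hom I) (hom_rep br I)"

definition restrict_last ::
    "'g::real_vector set \<Rightarrow> nat \<Rightarrow> ('g list \<Rightarrow> 'g set) \<Rightarrow> ('g list \<Rightarrow> 'g \<Rightarrow> 'g set)" where
  "restrict_last I k \<phi> = (\<lambda>xs\<in>{xs. length xs = k}. \<lambda>u\<in>I. \<phi> (xs @ [u]))"

definition Pi_map ::
    "'g::real_vector set \<Rightarrow> nat \<Rightarrow> ('g list \<Rightarrow> 'g set) \<Rightarrow> ('g list \<Rightarrow> 'g \<Rightarrow> 'g set)" where
  "Pi_map I k \<phi> = (-1) ^ (k + 1) \<odot>\<^bsub>cochains k (ideal_hom I)\<^esub> restrict_last I k \<phi>"


section \<open>Smooth curves\<close>

definition smooth_real_on :: "real set \<Rightarrow> (real \<Rightarrow> real) \<Rightarrow> bool" where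
  "smooth_real_on J f \<longleftrightarrow> (\<forall>n. \<forall>t\<in>J. (deriv ^^ n) f differentiable (at t))"

text \<open>
  Smoothness (on an open \<open>J\<close>) and derivative of a curve in a finite-dimensional space \<open>V\<close> are
  tested on linear functionals, i.e. on coordinates; no norm on \<open>V\<close> has to be chosen.
\<close>

definition smooth_curve_on :: "(real, 'v) module \<Rightarrow> real set \<Rightarrow> (real \<Rightarrow> 'v) \<Rightarrow> bool" where
  "smooth_curve_on V J c \<longleftrightarrow> (\<forall>t\<in>J. c t \<in> carrier V) \<and>
     (\<forall>l\<in>lin_maps V (subspace_module UNIV). smooth_real_on J (\<lambda>t. l (c t)))"

definition has_velocity :: "(real, 'v) module \<Rightarrow> (real \<Rightarrow> 'v) \<Rightarrow> 'v \<Rightarrow> real \<Rightarrow> bool" where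
  "has_velocity V c v t \<longleftrightarrow> v \<in> carrier V \<and>
     (\<forall>l\<in>lin_maps V (subspace_module UNIV). ((\<lambda>s. l (c s)) has_real_derivative l v) (at t))"

definition Gr :: "nat \<Rightarrow> 'g::real_vector set set" where
  "Gr d = {W. subspace W \<and> dim W = d}"

definition complement :: "'g::real_vector set \<Rightarrow> 'g set \<Rightarrow> bool" where
  "complement W C \<longleftrightarrow> subspace C \<and> W \<inter> C = {0} \<and> {w + c |w c. w \<in> W \<and> c \<in> C} = UNIV"

text \<open>
  The curve \<open>W\<close> near \<open>s\<close> in the chart of the Grassmannian around \<open>W s\<close> given by the complement \<open>C\<close>:
  \<open>W t\<close> is the graph of \<open>\<phi> t : W s \<rightarrow> C\<close>, and \<open>\<phi>\<close> is smooth.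
\<close>

definition smooth_chart_at ::
    "(real \<Rightarrow> 'g::real_vector set) \<Rightarrow> real \<Rightarrow> 'g set \<Rightarrow> (real \<Rightarrow> 'g \<Rightarrow> 'g) \<Rightarrow> bool" where
  "smooth_chart_at W s C \<phi> \<longleftrightarrow> complement (W s) C \<and>
     (\<exists>e>0. smooth_curve_on (hom_space (subspace_module (W s)) (subspace_module C))
              {s - e<..<s + e} \<phi> \<and>
            (\<forall>t\<in>{s - e<..<s + e}. W t = {u + \<phi> t u |u. u \<in> W s}))"

definition smooth_Gr_curve_on :: "nat \<Rightarrow> real set \<Rightarrow> (real \<Rightarrow> 'g::real_vector set) \<Rightarrow> bool" where
  "smooth_Gr_curve_on d J W \<longleftrightarrow>
     (\<forall>t\<in>J. W t \<in> Gr d) \<and> (\<forall>s\<in>J. \<exists>C \<phi>. smooth_chart_at W s C \<phi>)"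

text \<open>The velocity at \<open>s\<close> as an element of \<open>Hom(W s, g / W s)\<close>; it does not depend on the chart.\<close>

definition has_Gr_velocity ::
    "(real \<Rightarrow> 'g::real_vector set) \<Rightarrow> ('g \<Rightarrow> 'g set) \<Rightarrow> real \<Rightarrow> bool" where
  "has_Gr_velocity W \<eta> s \<longleftrightarrow> (\<exists>C \<phi> v. smooth_chart_at W s C \<phi> \<and>
     has_velocity (hom_space (subspace_module (W s)) (subspace_module C)) \<phi> v s \<and>
     \<eta> = (\<lambda>u\<in>W s. quot_proj (W s) (v u)))"


section \<open>Deformation cocycles\<close>

text \<open>\<open>C\<^sup>1\<close> is identified with the linear maps via \<open>x \<mapsto> \<psi> [x]\<close>, and \<open>C\<^sup>0\<close> with the coefficients
  via \<open>\<eta> []\<close>.\<close>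

definition morphism_deformation_cocycles ::
    "('g::real_vector \<Rightarrow> 'g \<Rightarrow> 'g) \<Rightarrow> 'g set \<Rightarrow> ('g list \<Rightarrow> 'g set) set" where
  "morphism_deformation_cocycles br I = {\<psi> \<in> carrier (cochains 1 (quot_space I)).
     \<exists>a b P. a < 0 \<and> 0 < b \<and>
       smooth_curve_on (hom_space (subspace_module UNIV) (quot_space I)) {a<..<b} P \<and>
       (\<forall>t\<in>{a<..<b}. \<forall>x y. P t (br x y) = quot_bracket br I (P t x) (P t y)) \<and>
       P 0 = quot_proj I \<and>
       has_velocity (hom_space (subspace_module UNIV) (quot_space I)) P (\<lambda>x. \<psi> [x]) 0}"

definition ideal_deformation_cocycles ::
    "('g::real_vector \<Rightarrow> 'g \<Rightarrow> 'g) \<Rightarrow> 'g set \<Rightarrow> ('g list \<Rightarrow> 'g \<Rightarrow> 'g set) set" where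
  "ideal_deformation_cocycles br I = {\<eta> \<in> carrier (cochains 0 (ideal_hom I)).
     \<exists>a b W. a < 0 \<and> 0 < b \<and>
       smooth_Gr_curve_on (dim I) {a<..<b} W \<and>
       (\<forall>t\<in>{a<..<b}. lie_ideal br (W t)) \<and>
       W 0 = I \<and>
       has_Gr_velocity W (\<eta> []) 0}"

end

theory Submission
  imports Defs
begin

text \<open>
  Choose a linear projection \<open>p\<close> of the Lie algebra with kernel \<open>I\<close>. It picks a representative in
  each coset, and every identity in \<open>g / I\<close> is checked on representatives.

  \<^emph>\<open>The cochain map.\<close> Up to sign, the map restricts the last argument \<open>u\<close> of a cochain to the ideal.
  In \<open>\<delta>\<phi>(x\<^sub>0, \<dots>, x\<^sub>k, u)\<close> the term in which \<open>u\<close> acts on the quotient vanishes, because an ideal acts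
  trivially on \<open>g / I\<close>. In the terms with a bracket \<open>[x\<^sub>i, u]\<close>, moving it from the first to the last
  place gives \<open>- (- 1)\<^sup>i \<phi>(\<dots>, [x\<^sub>i, u])\<close>, which is the second half of the action on \<open>Hom(I, g / I)\<close>
  (lemma \<open>bracket_terms_snoc\<close>). All other terms correspond one to one, so \<open>(\<delta>\<phi>)|\<close> equals
  \<open>\<delta>(\<phi>|)\<close>. The sign in the definition of the map alternates with the degree and absorbs the sign of
  the shifted differential (lemma \<open>Pi_map_ce_diff\<close>).

  \<^emph>\<open>Deformation cocycles.\<close> If \<open>P t\<close> is a curve of morphisms to \<open>g / I\<close> starting at the projection,
  then \<open>P t\<close> stays surjective for small \<open>t\<close> and \<open>W t = ker (P t)\<close> is a curve of ideals of constant
  dimension with \<open>W 0 = I\<close>. That it is smooth in the Grassmannian is the implicit function theorem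
  for linear equations (lemma \<open>kernel_chart\<close>): near \<open>s\<close>, the kernel is the graph of
  \<open>\<phi> t = - \<sigma> (P t \<sigma>)\<inverse> (P t)\<close> for a linear section \<open>\<sigma>\<close> of \<open>P s\<close>. The smooth inverse is built
  from rank one perturbations (lemma \<open>smooth_inverse_near_identity\<close>). At \<open>t = 0\<close> the derivative of
  \<open>P t (u + \<phi> t u) = 0\<close> says that the velocity of \<open>W\<close> is minus the restriction to \<open>I\<close> of the
  velocity of \<open>P\<close>, and this is its image under the map in degree \<open>0\<close>.
\<close>

section \<open>The quotient, seen inside the Lie algebra\<close>

lemma subspace_module_sel [simp]:
  "carrier (subspace_module S) = S" "x \<oplus>\<^bsub>subspace_module S\<^esub> y = x + y"
  "c \<odot>\<^bsub>subspace_module S\<^esub> x = c *\<^sub>R x" "\<zero>\<^bsub>subspace_module S\<^esub> = 0"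
  by (simp_all add: subspace_module_def)

lemma hom_space_sel:
  "carrier (hom_space V W) = lin_maps V W \<inter> extensional (carrier V)"
  "f \<oplus>\<^bsub>hom_space V W\<^esub> g = (\<lambda>x\<in>carrier V. f x \<oplus>\<^bsub>W\<^esub> g x)"
  "c \<odot>\<^bsub>hom_space V W\<^esub> f = (\<lambda>x\<in>carrier V. c \<odot>\<^bsub>W\<^esub> f x)"
  "\<zero>\<^bsub>hom_space V W\<^esub> = (\<lambda>x\<in>carrier V. \<zero>\<^bsub>W\<^esub>)"
  by (simp_all add: hom_space_def)

lemma additive_finsum:
  fixes h :: "'a \<Rightarrow> 'b::real_vector"
  assumes "abelian_monoid G" "finite A" "f \<in> A \<rightarrow> carrier G"
    and h: "\<And>a b. a \<in> carrier G \<Longrightarrow> b \<in> carrier G \<Longrightarrow> h (a \<oplus>\<^bsub>G\<^esub> b) = h a + h b"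
  shows "h (finsum G f A) = (\<Sum>a\<in>A. h (f a))"
proof -
  interpret abelian_monoid G by fact
  have "h \<zero>\<^bsub>G\<^esub> = 0"
    using h[of "\<zero>\<^bsub>G\<^esub>" "\<zero>\<^bsub>G\<^esub>"] by simp
  with assms(2,3) show ?thesis
  proof (induction A rule: finite_induct)
    case (insert a A)
    then have "f \<in> A \<rightarrow> carrier G" "f a \<in> carrier G" by auto
    with insert show ?case by (simp add: h)
  qed simp
qed

text \<open>
  A linear projection with kernel \<open>I\<close> selects a representative \<open>rep A\<close> in every coset \<open>A\<close>. It makes
  the quotient isomorphic to the range of \<open>p\<close>, so that sums in the quotient become sums of vectors.
\<close>

locale quotient_projection =
  fixes I :: "'g::real_vector set" and p :: "'g \<Rightarrow> 'g"
  assumes linear_p: "linear p" and p_idem [simp]: "p (p x) = p x"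
    and p_eq_0_iff: "p x = 0 \<longleftrightarrow> x \<in> I"
begin

abbreviation Q :: "(real, 'g set) module" where "Q \<equiv> quot_space I"

definition rep :: "'g set \<Rightarrow> 'g" where
  "rep A = p (SOME a. a \<in> A)"

lemma p_simps [simp]:
  "p (x + y) = p x + p y" "p (x - y) = p x - p y" "p (- x) = - p x"
  "p (c *\<^sub>R x) = c *\<^sub>R p x" "p 0 = 0"
  by (simp_all add: linear_p linear_add linear_diff linear_neg linear_cmul linear_0)

lemma subspace_I: "subspace I"
  by (simp add: subspace_def flip: p_eq_0_iff)

lemma quot_proj_fiber: "quot_proj I x = {y. p y = p x}"
proof -
  have "y \<in> quot_proj I x \<longleftrightarrow> p y = p x" for y
  proof
    assume "p y = p x"
    then have "y - x \<in> I" by (simp flip: p_eq_0_iff)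
    then show "y \<in> quot_proj I x"
      unfolding quot_proj_def by (auto intro!: exI[of _ "y - x"])
  qed (auto simp: quot_proj_def simp flip: p_eq_0_iff)
  then show ?thesis by auto
qed

lemma quot_proj_eq_iff: "quot_proj I x = quot_proj I y \<longleftrightarrow> p x = p y"
  by (auto simp: quot_proj_fiber)

lemma rep_quot_proj [simp]: "rep (quot_proj I x) = p x"
  unfolding rep_def quot_proj_fiber by (rule someI2[of _ x]) auto

lemma carrier_Q: "carrier Q = range (quot_proj I)"
  by (simp add: quot_space_def)

lemma quot_proj_carrier [simp]: "quot_proj I x \<in> carrier Q"
  by (simp add: carrier_Q)

lemma quot_proj_rep: "A \<in> carrier Q \<Longrightarrow> quot_proj I (rep A) = A"
  unfolding carrier_Q by (elim imageE) (simp add: quot_proj_eq_iff)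

lemma p_rep: "A \<in> carrier Q \<Longrightarrow> p (rep A) = rep A"
  by (auto simp: carrier_Q)

lemma rep_inject: "A \<in> carrier Q \<Longrightarrow> B \<in> carrier Q \<Longrightarrow> rep A = rep B \<Longrightarrow> A = B"
  by (metis quot_proj_rep)

lemma zero_Q: "\<zero>\<^bsub>Q\<^esub> = quot_proj I 0"
  by (auto simp: quot_space_def quot_proj_fiber p_eq_0_iff)

lemma add_quot_proj: "quot_proj I x \<oplus>\<^bsub>Q\<^esub> quot_proj I y = quot_proj I (x + y)"
proof -
  have "\<exists>a b. z = a + b \<and> p a = p x \<and> p b = p y" if "p z = p x + p y" for z
    using that by (intro exI[of _ x] exI[of _ "z - x"]) auto
  then show ?thesis by (auto simp: quot_space_def quot_proj_fiber)
qed

lemma smult_quot_proj: "c \<odot>\<^bsub>Q\<^esub> quot_proj I x = quot_proj I (c *\<^sub>R x)"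
proof -
  have "\<exists>a u. z = c *\<^sub>R a + u \<and> p a = p x \<and> u \<in> I" if "p z = c *\<^sub>R p x" for z
    using that by (intro exI[of _ x] exI[of _ "z - c *\<^sub>R x"]) (auto simp flip: p_eq_0_iff)
  then show ?thesis by (auto simp: quot_space_def quot_proj_fiber simp flip: p_eq_0_iff)
qed

lemma abelian_group_Q: "abelian_group Q"
proof (rule abelian_groupI)
  fix A assume "A \<in> carrier Q"
  then obtain x where "A = quot_proj I x" by (auto simp: carrier_Q)
  then show "\<exists>B\<in>carrier Q. B \<oplus>\<^bsub>Q\<^esub> A = \<zero>\<^bsub>Q\<^esub>"
    by (intro bexI[of _ "quot_proj I (- x)"]) (auto simp: add_quot_proj zero_Q)
qed (auto simp: carrier_Q add_quot_proj zero_Q ac_simps)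

sublocale Q: abelian_group Q by (rule abelian_group_Q)

lemma smult_closed: "A \<in> carrier Q \<Longrightarrow> c \<odot>\<^bsub>Q\<^esub> A \<in> carrier Q"
  by (auto simp: carrier_Q smult_quot_proj)

lemma rep_add: "A \<in> carrier Q \<Longrightarrow> B \<in> carrier Q \<Longrightarrow> rep (A \<oplus>\<^bsub>Q\<^esub> B) = rep A + rep B"
  by (auto simp: carrier_Q add_quot_proj)

lemma rep_smult: "A \<in> carrier Q \<Longrightarrow> rep (c \<odot>\<^bsub>Q\<^esub> A) = c *\<^sub>R rep A"
  by (auto simp: carrier_Q smult_quot_proj)

lemma rep_zero: "rep \<zero>\<^bsub>Q\<^esub> = 0"
  by (simp add: zero_Q)

lemma rep_minus:
  assumes "A \<in> carrier Q" "B \<in> carrier Q" shows "rep (A \<ominus>\<^bsub>Q\<^esub> B) = rep A - rep B"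
proof -
  have "A = (A \<ominus>\<^bsub>Q\<^esub> B) \<oplus>\<^bsub>Q\<^esub> B"
    using assms by (simp add: Q.minus_eq Q.a_assoc Q.l_neg)
  then have "rep A = rep (A \<ominus>\<^bsub>Q\<^esub> B) + rep B"
    using rep_add[of "A \<ominus>\<^bsub>Q\<^esub> B" B] assms by simp
  then show ?thesis by simp
qed

lemma rep_finsum:
  "finite A \<Longrightarrow> f \<in> A \<rightarrow> carrier Q \<Longrightarrow> rep (finsum Q f A) = (\<Sum>a\<in>A. rep (f a))"
  by (rule additive_finsum[OF Q.abelian_monoid_axioms _ _ rep_add])

lemma lin_maps_Q_iff:
  assumes "subspace S"
  shows "f \<in> lin_maps (subspace_module S) Q \<longleftrightarrow> f \<in> S \<rightarrow> carrier Q \<and>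
    (\<forall>x\<in>S. \<forall>y\<in>S. rep (f (x + y)) = rep (f x) + rep (f y)) \<and>
    (\<forall>c. \<forall>x\<in>S. rep (f (c *\<^sub>R x)) = c *\<^sub>R rep (f x))"
proof -
  have "f (x + y) = f x \<oplus>\<^bsub>Q\<^esub> f y \<longleftrightarrow> rep (f (x + y)) = rep (f x) + rep (f y)"
    "f (c *\<^sub>R x) = c \<odot>\<^bsub>Q\<^esub> f x \<longleftrightarrow> rep (f (c *\<^sub>R x)) = c *\<^sub>R rep (f x)"
    if "f \<in> S \<rightarrow> carrier Q" "x \<in> S" "y \<in> S" for x y c
  proof -
    from that have "f x \<in> carrier Q" "f y \<in> carrier Q" "f (x + y) \<in> carrier Q"
        "f (c *\<^sub>R x) \<in> carrier Q"
      using assms by (auto simp: subspace_add subspace_scale)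
    then show "f (x + y) = f x \<oplus>\<^bsub>Q\<^esub> f y \<longleftrightarrow> rep (f (x + y)) = rep (f x) + rep (f y)"
      "f (c *\<^sub>R x) = c \<odot>\<^bsub>Q\<^esub> f x \<longleftrightarrow> rep (f (c *\<^sub>R x)) = c *\<^sub>R rep (f x)"
      by (metis rep_add rep_inject Q.a_closed, metis rep_smult rep_inject smult_closed)
  qed
  then show ?thesis
    unfolding lin_maps_def by simp blast
qed

lemma ideal_hom_sel:
  "f \<oplus>\<^bsub>ideal_hom I\<^esub> g = (\<lambda>u\<in>I. f u \<oplus>\<^bsub>Q\<^esub> g u)"
  "c \<odot>\<^bsub>ideal_hom I\<^esub> f = (\<lambda>u\<in>I. c \<odot>\<^bsub>Q\<^esub> f u)"
  "\<zero>\<^bsub>ideal_hom I\<^esub> = (\<lambda>u\<in>I. \<zero>\<^bsub>Q\<^esub>)"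
  by (simp_all add: ideal_hom_def hom_space_sel)

lemma carrier_ideal_hom:
  "f \<in> carrier (ideal_hom I) \<longleftrightarrow> f \<in> extensional I \<and> f \<in> I \<rightarrow> carrier Q \<and>
    (\<forall>x\<in>I. \<forall>y\<in>I. rep (f (x + y)) = rep (f x) + rep (f y)) \<and>
    (\<forall>c. \<forall>x\<in>I. rep (f (c *\<^sub>R x)) = c *\<^sub>R rep (f x))"
  by (auto simp: ideal_hom_def hom_space_sel lin_maps_Q_iff[OF subspace_I])

lemma ideal_hom_apply: "f \<in> carrier (ideal_hom I) \<Longrightarrow> u \<in> I \<Longrightarrow> f u \<in> carrier Q"
  by (auto simp: carrier_ideal_hom)

lemma ideal_hom_eqI:
  assumes "f \<in> extensional I" "g \<in> extensional I" "f \<in> I \<rightarrow> carrier Q" "g \<in> I \<rightarrow> carrier Q"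
    "\<And>u. u \<in> I \<Longrightarrow> rep (f u) = rep (g u)"
  shows "f = g"
  using assms by (intro extensionalityI[of f I g] rep_inject) (simp_all add: Pi_iff)

lemmas I_closed = subspace_add[OF subspace_I] subspace_scale[OF subspace_I]
  subspace_0[OF subspace_I]

lemma ideal_hom_add_closed:
  "f \<in> carrier (ideal_hom I) \<Longrightarrow> g \<in> carrier (ideal_hom I) \<Longrightarrow>
     f \<oplus>\<^bsub>ideal_hom I\<^esub> g \<in> carrier (ideal_hom I)"
  using I_closed
  by (simp add: carrier_ideal_hom ideal_hom_sel Pi_iff rep_add scaleR_add_right)

lemma ideal_hom_smult_closed:
  "f \<in> carrier (ideal_hom I) \<Longrightarrow> c \<odot>\<^bsub>ideal_hom I\<^esub> f \<in> carrier (ideal_hom I)"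
  using I_closed
  by (simp add: carrier_ideal_hom ideal_hom_sel Pi_iff rep_smult smult_closed scaleR_add_right)

lemma ideal_hom_zero_closed: "\<zero>\<^bsub>ideal_hom I\<^esub> \<in> carrier (ideal_hom I)"
  using I_closed
  by (simp add: carrier_ideal_hom ideal_hom_sel Pi_iff rep_zero)

lemma abelian_monoid_ideal_hom: "abelian_monoid (ideal_hom I)"
proof (rule abelian_monoidI)
  fix f g h assume fgh: "f \<in> carrier (ideal_hom I)" "g \<in> carrier (ideal_hom I)"
      "h \<in> carrier (ideal_hom I)"
  then show "f \<oplus>\<^bsub>ideal_hom I\<^esub> g \<in> carrier (ideal_hom I)"
    by (intro ideal_hom_add_closed)
  note car = fgh[THEN ideal_hom_apply]
  have ext: "f \<in> extensional I" using fgh by (simp add: carrier_ideal_hom)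
  show "f \<oplus>\<^bsub>ideal_hom I\<^esub> g \<oplus>\<^bsub>ideal_hom I\<^esub> h = f \<oplus>\<^bsub>ideal_hom I\<^esub> (g \<oplus>\<^bsub>ideal_hom I\<^esub> h)"
    "f \<oplus>\<^bsub>ideal_hom I\<^esub> g = g \<oplus>\<^bsub>ideal_hom I\<^esub> f"
    by (simp add: ideal_hom_sel car Q.a_assoc cong: restrict_cong)
      (simp add: ideal_hom_sel car Q.a_comm cong: restrict_cong)
  show "\<zero>\<^bsub>ideal_hom I\<^esub> \<oplus>\<^bsub>ideal_hom I\<^esub> f = f"
    using ext by (intro extensionalityI[of _ I]) (simp_all add: ideal_hom_sel car)
qed (rule ideal_hom_zero_closed)

sublocale H: abelian_monoid "ideal_hom I" by (rule abelian_monoid_ideal_hom)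

lemma rep_ideal_hom_finsum:
  "finite A \<Longrightarrow> f \<in> A \<rightarrow> carrier (ideal_hom I) \<Longrightarrow> u \<in> I \<Longrightarrow>
    rep (finsum (ideal_hom I) f A u) = (\<Sum>a\<in>A. rep (f a u))"
  by (rule additive_finsum[OF H.abelian_monoid_axioms, where h = "\<lambda>f. rep (f u)"])
    (auto simp: ideal_hom_sel rep_add ideal_hom_apply)

end

locale ideal_projection = quotient_projection I p for I :: "'g::real_vector set" and p +
  fixes br :: "'g \<Rightarrow> 'g \<Rightarrow> 'g"
  assumes lie: "lie_algebra br" and ideal: "lie_ideal br I"
begin

lemma br_simps [simp]:
  "br (x + y) z = br x z + br y z" "br z (x + y) = br z x + br z y"
  "br z (x - y) = br z x - br z y"
  "br (c *\<^sub>R x) z = c *\<^sub>R br x z" "br z (c *\<^sub>R x) = c *\<^sub>R br z x"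
proof -
  have "linear (br x)" "linear (\<lambda>x. br x y)" for x y
    using lie unfolding lie_algebra_def bilinear_def by auto
  note l = this
  show "br (x + y) z = br x z + br y z" "br z (x + y) = br z x + br z y"
    "br z (x - y) = br z x - br z y"
    "br (c *\<^sub>R x) z = c *\<^sub>R br x z" "br z (c *\<^sub>R x) = c *\<^sub>R br z x"
    using linear_add[OF l(2)] linear_add[OF l(1)] linear_diff[OF l(1)] linear_cmul[OF l(2)]
      linear_cmul[OF l(1)]
    by auto
qed

lemma br_self: "br x x = 0"
  using lie by (simp add: lie_algebra_def)

lemma br_anticommute: "br x y = - br y x"
proof -
  have "br x x + br y x + (br x y + br y y) = 0"
    using br_self[of "x + y"] unfolding br_simps(1,2) by (simp only: ac_simps)
  then show ?thesis
    by (simp add: br_self eq_neg_iff_add_eq_0 add.commute)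
qed

lemma br_ideal: "u \<in> I \<Longrightarrow> br x u \<in> I"
  using ideal by (simp add: lie_ideal_def)

lemma br_ideal': "u \<in> I \<Longrightarrow> br u x \<in> I"
  using br_ideal[of u x] br_anticommute[of u x] subspace_neg[OF subspace_I] by metis

text \<open>The bracket descends to the quotient because \<open>I\<close> absorbs brackets on both sides.\<close>

lemma p_br_cong:
  assumes "p x = p x'" "p y = p y'" shows "p (br x y) = p (br x' y')"
proof -
  have "x - x' \<in> I" "y - y' \<in> I" using assms by (simp_all flip: p_eq_0_iff)
  then have "p (br (x - x') y) = 0" "p (br x' (y - y')) = 0"
    by (simp_all only: p_eq_0_iff br_ideal br_ideal')
  moreover have "br x y = br (x - x') y + br x' y"
    using br_simps(1)[of "x - x'" x' y] by simp
  ultimately show ?thesis by simp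
qed

lemma quot_bracket_quot_proj:
  "quot_bracket br I (quot_proj I x) (quot_proj I y) = quot_proj I (br x y)"
proof -
  have "\<exists>a b u. z = br a b + u \<and> p a = p x \<and> p b = p y \<and> u \<in> I" if "p z = p (br x y)" for z
  proof (intro exI conjI)
    show "z = br x y + (z - br x y)" by simp
    show "z - br x y \<in> I" using that by (simp flip: p_eq_0_iff)
  qed (rule refl)+
  moreover have "p (br a b + u) = p (br x y)" if "p a = p x" "p b = p y" "u \<in> I" for a b u
    using p_br_cong[OF that(1,2)] that(3) p_eq_0_iff[of u] by simp
  ultimately show ?thesis
    unfolding quot_bracket_def quot_proj_fiber mem_Collect_eq by blast
qed

lemma quot_rep_closed: "A \<in> carrier Q \<Longrightarrow> quot_rep br I x A \<in> carrier Q"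
  by (auto simp: carrier_Q quot_rep_def quot_bracket_quot_proj)

lemma rep_quot_rep: "A \<in> carrier Q \<Longrightarrow> rep (quot_rep br I x A) = p (br x (rep A))"
  unfolding carrier_Q
  by (elim imageE) (simp add: quot_rep_def quot_bracket_quot_proj p_br_cong[OF refl p_idem])

lemma hom_rep_apply:
  "u \<in> I \<Longrightarrow> hom_rep br I x f u = quot_rep br I x (f u) \<ominus>\<^bsub>Q\<^esub> f (br x u)"
  by (simp add: hom_rep_def quot_rep_def)

lemma rep_hom_rep:
  "f \<in> carrier (ideal_hom I) \<Longrightarrow> u \<in> I \<Longrightarrow>
    rep (hom_rep br I x f u) = p (br x (rep (f u))) - rep (f (br x u))"
  by (simp add: hom_rep_apply rep_minus rep_quot_rep quot_rep_closed ideal_hom_apply br_ideal)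

lemma hom_rep_closed:
  assumes f: "f \<in> carrier (ideal_hom I)" shows "hom_rep br I x f \<in> carrier (ideal_hom I)"
proof -
  have "hom_rep br I x f u \<in> carrier Q" if "u \<in> I" for u
    using that f by (simp add: hom_rep_apply quot_rep_closed ideal_hom_apply br_ideal)
  then show ?thesis
    using f I_closed br_ideal
    by (simp add: carrier_ideal_hom[of "hom_rep br I x f"] rep_hom_rep Pi_iff)
      (simp add: carrier_ideal_hom hom_rep_def algebra_simps)
qed

end

section \<open>Alternating maps\<close>

definition alternating_map :: "nat \<Rightarrow> ('g::real_vector list \<Rightarrow> 'v::real_vector) \<Rightarrow> bool" where
  "alternating_map n F \<longleftrightarrow>
     (\<forall>xs k. length xs = n \<and> k < n \<longrightarrow> linear (\<lambda>x. F (xs[k := x]))) \<and>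
     (\<forall>xs i j. length xs = n \<and> i < j \<and> j < n \<and> xs ! i = xs ! j \<longrightarrow> F xs = 0)"

lemma alternating_add:
  assumes "alternating_map n F" "length ws + length zs + 1 = n"
  shows "F (ws @ (x + y) # zs) = F (ws @ x # zs) + F (ws @ y # zs)"
proof -
  have "length (ws @ x # zs) = n" "length ws < n"
    using assms(2) by simp_all
  then have "linear (\<lambda>v. F ((ws @ x # zs)[length ws := v]))"
    using assms(1) unfolding alternating_map_def by blast
  from linear_add[OF this, of x y] show ?thesis by simp
qed

lemma alternating_repeat:
  assumes "alternating_map n F" "length ws + length zs + 2 = n"
  shows "F (ws @ x # x # zs) = 0"
proof -
  have "length (ws @ x # x # zs) = n" "length ws < Suc (length ws)" "Suc (length ws) < n"
    "(ws @ x # x # zs) ! length ws = (ws @ x # x # zs) ! Suc (length ws)"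
    using assms(2) by (auto simp: nth_append)
  then show ?thesis
    using assms(1) unfolding alternating_map_def by blast
qed

text \<open>Polarization: expand \<open>F\<close> with \<open>x + y\<close> in both places.\<close>

lemma alternating_swap:
  assumes "alternating_map n F" "length ws + length zs + 2 = n"
  shows "F (ws @ x # y # zs) = - F (ws @ y # x # zs)"
proof -
  have add1: "F (ws @ (x + y) # z # zs) = F (ws @ x # z # zs) + F (ws @ y # z # zs)" for z
    using alternating_add[OF assms(1), of ws "z # zs" x y] assms(2) by simp
  have add2: "F (ws @ z # (x + y) # zs) = F (ws @ z # x # zs) + F (ws @ z # y # zs)" for z
    using alternating_add[OF assms(1), of "ws @ [z]" zs x y] assms(2) by simp
  have "F (ws @ (x + y) # (x + y) # zs) = 0"
    by (rule alternating_repeat[OF assms])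
  then have "F (ws @ x # y # zs) + F (ws @ y # x # zs) = 0"
    unfolding add1 add2 using alternating_repeat[OF assms] by (simp add: add.commute)
  then show ?thesis by (simp add: eq_neg_iff_add_eq_0)
qed

lemma alternating_move_last:
  assumes "alternating_map n F" "length ws + length zs + 1 = n"
  shows "F (ws @ y # zs) = (- 1) ^ length zs *\<^sub>R F (ws @ zs @ [y])"
  using assms(2)
proof (induction zs arbitrary: ws)
  case (Cons z zs)
  have "F (ws @ y # z # zs) = - F ((ws @ [z]) @ y # zs)"
    using alternating_swap[OF assms(1), of ws zs y z] Cons.prems by simp
  also have "\<dots> = - ((- 1) ^ length zs *\<^sub>R F ((ws @ [z]) @ zs @ [y]))"
    using Cons.IH[of "ws @ [z]"] Cons.prems by simp
  finally show ?case by simp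
qed simp

section \<open>Omitting arguments\<close>

lemma nths_omit_snoc:
  assumes "A \<subseteq> {..<length xs}"
  shows "nths (xs @ [u]) (- A) = nths xs (- A) @ [u]"
  using assms by (auto simp: nths_append nths_singleton)

lemma nths_omit_snoc_last:
  "nths (xs @ [u]) (- insert (length xs) A) = nths xs (- A)"
proof -
  have "nths xs (- insert (length xs) A) = nths xs (- A)"
    unfolding nths_def by (intro arg_cong[of _ _ "map fst"] filter_cong) (auto simp: set_zip)
  then show ?thesis by (auto simp: nths_append nths_singleton)
qed

lemma length_nths_omit:
  "finite A \<Longrightarrow> A \<subseteq> {..<length xs} \<Longrightarrow> length (nths xs (- A)) = length xs - card A"
proof -
  assume A: "finite A" "A \<subseteq> {..<length xs}"
  have "{i. i < length xs \<and> i \<in> - A} = {..<length xs} - A" by auto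
  with A show ?thesis by (simp add: length_nths card_Diff_subset)
qed

text \<open>
  The pairs \<open>(i, j)\<close> split according to whether \<open>j\<close> is the position of the last argument \<open>u\<close>.
  If it is, the bracket with \<open>u\<close> has to travel from the front of the list back to the end, past
  \<open>k\<close> arguments, which turns the sign \<open>(- 1) ^ (i + k + 1)\<close> into \<open>- (- 1) ^ i\<close>.
\<close>

lemma bracket_terms_snoc:
  assumes F: "alternating_map (Suc k) F" and len: "length xs = Suc k"
  shows "(\<Sum>(i, j)\<in>{(i, j). i < j \<and> j \<le> Suc k}. (- 1) ^ (i + j) *\<^sub>R
      F (br ((xs @ [u]) ! i) ((xs @ [u]) ! j) # nths (xs @ [u]) (- {i, j}))) =
    (\<Sum>(i, j)\<in>{(i, j). i < j \<and> j \<le> k}. (- 1) ^ (i + j) *\<^sub>R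
      F ((br (xs ! i) (xs ! j) # nths xs (- {i, j})) @ [u])) -
    (\<Sum>i\<le>k. (- 1) ^ i *\<^sub>R F (nths xs (- {i}) @ [br (xs ! i) u]))"
proof -
  let ?P = "{(i, j). i < j \<and> j \<le> k}" and ?L = "(\<lambda>i. (i, Suc k)) ` {..k}"
  let ?t = "\<lambda>(i, j). (- 1) ^ (i + j) *\<^sub>R
      F (br ((xs @ [u]) ! i) ((xs @ [u]) ! j) # nths (xs @ [u]) (- {i, j}))"
  have split: "{(i, j). i < j \<and> j \<le> Suc k} = ?P \<union> ?L" by auto
  have "?P \<subseteq> {..k} \<times> {..k}" by auto
  then have fin: "finite ?P" by (rule finite_subset) simp
  have "sum ?t ?P = (\<Sum>(i, j)\<in>?P. (- 1) ^ (i + j) *\<^sub>R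
      F ((br (xs ! i) (xs ! j) # nths xs (- {i, j})) @ [u]))"
    using len by (intro sum.cong refl) (auto simp: nth_append nths_omit_snoc)
  moreover have "sum ?t ?L = - (\<Sum>i\<le>k. (- 1) ^ i *\<^sub>R F (nths xs (- {i}) @ [br (xs ! i) u]))"
  proof -
    have "?t (i, Suc k) = - ((- 1) ^ i *\<^sub>R F (nths xs (- {i}) @ [br (xs ! i) u]))" if "i \<le> k" for i
    proof -
      have n: "length (nths xs (- {i})) = k"
        using that len length_nths_omit[of "{i}" xs] by simp
      have "{i, Suc k} = insert (length xs) {i}" using len by auto
      then have "nths (xs @ [u]) (- {i, Suc k}) = nths xs (- {i})"
        using nths_omit_snoc_last[of xs u "{i}"] by simp
      then have "?t (i, Suc k) = (- 1) ^ (i + Suc k) *\<^sub>R F (br (xs ! i) u # nths xs (- {i}))"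
        using that len by (simp add: nth_append)
      also have "F (br (xs ! i) u # nths xs (- {i})) =
          (- 1) ^ k *\<^sub>R F (nths xs (- {i}) @ [br (xs ! i) u])"
        using alternating_move_last[OF F, of "[]" "nths xs (- {i})"] n by simp
      finally show ?thesis
        by (simp add: power_add flip: power_mult_distrib)
    qed
    then show ?thesis
      by (simp add: sum.reindex inj_on_def sum_negf)
  qed
  ultimately show ?thesis
    unfolding split using fin by (subst sum.union_disjoint) auto
qed

section \<open>The cochain map\<close>

lemma cochains_sel:
  "c \<odot>\<^bsub>cochains p V\<^esub> \<omega> = (\<lambda>xs\<in>{xs. length xs = p}. c \<odot>\<^bsub>V\<^esub> \<omega> xs)"
  "\<omega> \<oplus>\<^bsub>cochains p V\<^esub> \<eta> = (\<lambda>xs\<in>{xs. length xs = p}. \<omega> xs \<oplus>\<^bsub>V\<^esub> \<eta> xs)"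
  by (simp_all add: cochains_def)

context quotient_projection
begin

lemma cochain_apply: "\<phi> \<in> carrier (cochains n V) \<Longrightarrow> length xs = n \<Longrightarrow> \<phi> xs \<in> carrier V"
  by (auto simp: cochains_def)

lemma carrier_cochains_Q:
  "\<phi> \<in> carrier (cochains n Q) \<longleftrightarrow>
    \<phi> \<in> {xs. length xs = n} \<rightarrow>\<^sub>E carrier Q \<and> alternating_map n (\<lambda>xs. rep (\<phi> xs))"
proof (cases "\<phi> \<in> {xs. length xs = n} \<rightarrow>\<^sub>E carrier Q")
  case True
  then have car: "\<phi> xs \<in> carrier Q" if "length xs = n" for xs
    using that by auto
  have "(\<lambda>x. \<phi> (xs[k := x])) \<in> lin_maps (subspace_module UNIV) Q \<longleftrightarrow>
      linear (\<lambda>x. rep (\<phi> (xs[k := x])))" if "length xs = n" for xs k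
    unfolding lin_maps_Q_iff[OF subspace_UNIV] linear_iff using that by (simp add: car)
  moreover have "\<phi> xs = \<zero>\<^bsub>Q\<^esub> \<longleftrightarrow> rep (\<phi> xs) = 0" if "length xs = n" for xs
    using rep_inject[OF car[OF that] Q.zero_closed] by (auto simp: rep_zero)
  ultimately show ?thesis
    using True unfolding cochains_def alternating_map_def by simp
qed (auto simp: cochains_def)

lemma Pi_map_apply:
  "length xs = k \<Longrightarrow> u \<in> I \<Longrightarrow> Pi_map I k \<phi> xs u = (- 1) ^ (k + 1) \<odot>\<^bsub>Q\<^esub> \<phi> (xs @ [u])"
  by (simp add: Pi_map_def cochains_sel restrict_last_def ideal_hom_sel)

lemma Pi_map_extensional:
  "Pi_map I k \<phi> \<in> extensional {xs. length xs = k}"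
  "length xs = k \<Longrightarrow> Pi_map I k \<phi> xs \<in> extensional I"
  by (simp_all add: Pi_map_def cochains_sel ideal_hom_sel)

lemma rep_Pi_map:
  "\<phi> \<in> carrier (cochains (Suc k) Q) \<Longrightarrow> length xs = k \<Longrightarrow> u \<in> I \<Longrightarrow>
    rep (Pi_map I k \<phi> xs u) = (- 1) ^ (k + 1) *\<^sub>R rep (\<phi> (xs @ [u]))"
  by (simp add: Pi_map_apply rep_smult cochain_apply)

lemma Pi_map_apply_closed:
  "\<phi> \<in> carrier (cochains (Suc k) Q) \<Longrightarrow> length xs = k \<Longrightarrow> u \<in> I \<Longrightarrow> Pi_map I k \<phi> xs u \<in> carrier Q"
  by (simp add: Pi_map_apply smult_closed cochain_apply)

lemma Pi_map_values:
  assumes \<phi>: "\<phi> \<in> carrier (cochains (Suc k) Q)" and len: "length xs = k"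
  shows "Pi_map I k \<phi> xs \<in> carrier (ideal_hom I)"
proof -
  have "linear (\<lambda>u. rep (\<phi> ((xs @ [0])[k := u])))"
    using \<phi> len unfolding carrier_cochains_Q alternating_map_def by simp
  then have "linear (\<lambda>u. rep (\<phi> (xs @ [u])))"
    using len by (simp add: list_update_append)
  then show ?thesis
    unfolding carrier_ideal_hom using Pi_map_extensional(2)[OF len] I_closed
    by (simp add: rep_Pi_map[OF assms] Pi_map_apply_closed[OF assms] linear_iff scaleR_add_right)
qed

lemma lin_maps_ideal_hom_iff:
  "f \<in> lin_maps (subspace_module UNIV) (ideal_hom I) \<longleftrightarrow>
    (\<forall>x. f x \<in> carrier (ideal_hom I)) \<and> (\<forall>u\<in>I. linear (\<lambda>x. rep (f x u)))"
proof (cases "\<forall>x. f x \<in> carrier (ideal_hom I)")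
  case True
  have "f (x + y) = f x \<oplus>\<^bsub>ideal_hom I\<^esub> f y \<longleftrightarrow> (\<forall>u\<in>I. rep (f (x + y) u) = rep (f x u) + rep (f y u))"
    (is "?l = ?r") for x y
  proof
    assume ?r
    then show ?l
      using True[rule_format, THEN ideal_hom_apply]
        H.a_closed[OF True[rule_format] True[rule_format], of x y, THEN ideal_hom_apply]
        True H.a_closed[OF True[rule_format] True[rule_format], of x y]
      by (intro ideal_hom_eqI) (auto simp: carrier_ideal_hom ideal_hom_sel rep_add)
  qed (use True in \<open>simp add: ideal_hom_sel rep_add ideal_hom_apply\<close>)
  moreover have "f (c *\<^sub>R x) = c \<odot>\<^bsub>ideal_hom I\<^esub> f x \<longleftrightarrow>
      (\<forall>u\<in>I. rep (f (c *\<^sub>R x) u) = c *\<^sub>R rep (f x u))"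
    (is "?l = ?r") for c x
  proof
    assume ?r
    then show ?l
      using True[rule_format, THEN ideal_hom_apply]
        True ideal_hom_smult_closed[OF True[rule_format], of c x]
      by (intro ideal_hom_eqI) (auto simp: carrier_ideal_hom ideal_hom_sel rep_smult)
  qed (use True in \<open>simp add: ideal_hom_sel rep_smult ideal_hom_apply\<close>)
  ultimately show ?thesis
    using True unfolding lin_maps_def linear_iff by auto
qed (auto simp: lin_maps_def)

lemma Pi_map_carrier:
  assumes \<phi>: "\<phi> \<in> carrier (cochains (Suc k) Q)"
  shows "Pi_map I k \<phi> \<in> carrier (cochains k (ideal_hom I))"
proof -
  note alt = \<phi>[unfolded carrier_cochains_Q alternating_map_def, THEN conjunct2]
  have lin: "(\<lambda>x. Pi_map I k \<phi> (xs[i := x])) \<in> lin_maps (subspace_module UNIV) (ideal_hom I)"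
    if "length xs = k" "i < k" for xs i
    unfolding lin_maps_ideal_hom_iff
  proof (intro conjI allI ballI)
    fix u assume u: "u \<in> I"
    have "linear (\<lambda>x. rep (\<phi> ((xs @ [u])[i := x])))"
      using alt that by simp
    then have "linear (\<lambda>x. rep (\<phi> (xs[i := x] @ [u])))"
      using that by (simp add: list_update_append)
    then show "linear (\<lambda>x. rep (Pi_map I k \<phi> (xs[i := x]) u))"
      using that u by (simp add: rep_Pi_map[OF \<phi>] linear_iff scaleR_add_right)
  qed (use that in \<open>simp add: Pi_map_values[OF \<phi>]\<close>)
  have zero: "Pi_map I k \<phi> xs = \<zero>\<^bsub>ideal_hom I\<^esub>"
    if "length xs = k" "i < j" "j < k" "xs ! i = xs ! j" for xs i j
  proof (rule ideal_hom_eqI)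
    fix u assume u: "u \<in> I"
    have "length (xs @ [u]) = Suc k" "j < Suc k" "(xs @ [u]) ! i = (xs @ [u]) ! j"
      using that by (simp_all add: nth_append)
    then have "rep (\<phi> (xs @ [u])) = 0"
      using alt that(2) by blast
    then show "rep (Pi_map I k \<phi> xs u) = rep (\<zero>\<^bsub>ideal_hom I\<^esub> u)"
      using that u by (simp add: rep_Pi_map[OF \<phi>] ideal_hom_sel rep_zero)
  qed (use that Pi_map_extensional(2) Pi_map_apply_closed[OF \<phi>] ideal_hom_zero_closed in
      \<open>auto simp: carrier_ideal_hom\<close>)
  have "Pi_map I k \<phi> \<in> {xs. length xs = k} \<rightarrow>\<^sub>E carrier (ideal_hom I)"
    using Pi_map_extensional(1) Pi_map_values[OF \<phi>] by (auto simp: PiE_def)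
  with lin zero show ?thesis
    by (simp add: cochains_def) blast
qed

lemma Pi_map_linear: "Pi_map I k \<in> lin_maps (cochains (Suc k) Q) (cochains k (ideal_hom I))"
proof -
  have "Pi_map I k (\<phi> \<oplus>\<^bsub>cochains (Suc k) Q\<^esub> \<psi>) =
      Pi_map I k \<phi> \<oplus>\<^bsub>cochains k (ideal_hom I)\<^esub> Pi_map I k \<psi>" (is "?l = ?r")
    if \<phi>: "\<phi> \<in> carrier (cochains (Suc k) Q)" "\<psi> \<in> carrier (cochains (Suc k) Q)" for \<phi> \<psi>
  proof (rule extensionalityI[of _ "{xs. length xs = k}"])
    fix xs :: "'g list" assume "xs \<in> {xs. length xs = k}"
    then have len: "length xs = k" by simp
    show "?l xs = ?r xs"
    proof (rule extensionalityI[of _ I])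
      fix u assume "u \<in> I"
      then show "?l xs u = ?r xs u"
        using len that
        by (intro rep_inject) (simp_all add: Pi_map_apply cochains_sel ideal_hom_sel rep_smult
          rep_add
            smult_closed cochain_apply scaleR_add_right)
    qed (use len Pi_map_extensional in \<open>simp_all add: cochains_sel ideal_hom_sel\<close>)
  qed (simp_all add: Pi_map_extensional cochains_sel)
  moreover have "Pi_map I k (c \<odot>\<^bsub>cochains (Suc k) Q\<^esub> \<phi>) =
      c \<odot>\<^bsub>cochains k (ideal_hom I)\<^esub> Pi_map I k \<phi>" (is "?l = ?r")
    if \<phi>: "\<phi> \<in> carrier (cochains (Suc k) Q)" for c \<phi>
  proof (rule extensionalityI[of _ "{xs. length xs = k}"])
    fix xs :: "'g list" assume "xs \<in> {xs. length xs = k}"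
    then have len: "length xs = k" by simp
    show "?l xs = ?r xs"
    proof (rule extensionalityI[of _ I])
      fix u assume "u \<in> I"
      then show "?l xs u = ?r xs u"
        using len that
        by (intro rep_inject) (simp_all add: Pi_map_apply cochains_sel ideal_hom_sel rep_smult
            smult_closed cochain_apply)
    qed (use len Pi_map_extensional in \<open>simp_all add: cochains_sel ideal_hom_sel\<close>)
  qed (simp_all add: Pi_map_extensional cochains_sel)
  ultimately show ?thesis
    unfolding lin_maps_def using Pi_map_carrier by blast
qed

end

context ideal_projection
begin

lemma cochain_omit_closed:
  assumes "\<phi> \<in> carrier (cochains n V)" "length ys = Suc n"
  shows "i \<le> n \<Longrightarrow> \<phi> (nths ys (- {i})) \<in> carrier V"
    "i < j \<Longrightarrow> j \<le> n \<Longrightarrow> \<phi> (x # nths ys (- {i, j})) \<in> carrier V"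
proof -
  show "\<phi> (nths ys (- {i})) \<in> carrier V" if "i \<le> n"
    using that assms(2) length_nths_omit[of "{i}" ys] by (intro cochain_apply[OF assms(1)]) simp
  show "\<phi> (x # nths ys (- {i, j})) \<in> carrier V" if "i < j" "j \<le> n"
    using that assms(2) length_nths_omit[of "{i, j}" ys] by (intro cochain_apply[OF assms(1)]) simp
qed

lemma finite_pairs: "finite {(i, j). i < j \<and> j \<le> (n::nat)}"
  by (rule finite_subset[of _ "{..n} \<times> {..n}"]) auto

lemma rep_ce_diff_Q:
  assumes \<phi>: "\<phi> \<in> carrier (cochains n Q)" and len: "length ys = Suc n"
  shows "rep (ce_diff br Q (quot_rep br I) n \<phi> ys) =
      (\<Sum>i\<le>n. (- 1) ^ i *\<^sub>R p (br (ys ! i) (rep (\<phi> (nths ys (- {i})))))) +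
      (\<Sum>(i, j)\<in>{(i, j). i < j \<and> j \<le> n}. (- 1) ^ (i + j) *\<^sub>R
        rep (\<phi> (br (ys ! i) (ys ! j) # nths ys (- {i, j}))))"
    and "ce_diff br Q (quot_rep br I) n \<phi> ys \<in> carrier Q"
proof -
  note cl = cochain_omit_closed[OF \<phi> len]
  have 1: "(\<lambda>i. (- 1) ^ i \<odot>\<^bsub>Q\<^esub> quot_rep br I (ys ! i) (\<phi> (nths ys (- {i})))) \<in> {..n} \<rightarrow> carrier Q"
    using cl by (auto intro!: smult_closed quot_rep_closed)
  have 2: "(\<lambda>(i, j). (- 1) ^ (i + j) \<odot>\<^bsub>Q\<^esub> \<phi> (br (ys ! i) (ys ! j) # nths ys (- {i, j})))
      \<in> {(i, j). i < j \<and> j \<le> n} \<rightarrow> carrier Q"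
    using cl by (auto intro!: smult_closed)
  show "ce_diff br Q (quot_rep br I) n \<phi> ys \<in> carrier Q"
    using len 1 2 by (simp add: ce_diff_def Q.finsum_closed)
  have "rep (ce_diff br Q (quot_rep br I) n \<phi> ys) =
      (\<Sum>i\<le>n. rep ((- 1) ^ i \<odot>\<^bsub>Q\<^esub> quot_rep br I (ys ! i) (\<phi> (nths ys (- {i}))))) +
      (\<Sum>z\<in>{(i, j). i < j \<and> j \<le> n}. rep (case z of (i, j) \<Rightarrow>
        (- 1) ^ (i + j) \<odot>\<^bsub>Q\<^esub> \<phi> (br (ys ! i) (ys ! j) # nths ys (- {i, j}))))"
    using len rep_finsum[OF _ 1] rep_finsum[OF finite_pairs 2]
    by (simp add: ce_diff_def rep_add Q.finsum_closed 1 2)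
  also have "\<dots> = (\<Sum>i\<le>n. (- 1) ^ i *\<^sub>R p (br (ys ! i) (rep (\<phi> (nths ys (- {i})))))) +
      (\<Sum>(i, j)\<in>{(i, j). i < j \<and> j \<le> n}. (- 1) ^ (i + j) *\<^sub>R
        rep (\<phi> (br (ys ! i) (ys ! j) # nths ys (- {i, j}))))"
    using cl by (intro arg_cong2[of _ _ _ _ "(+)"] sum.cong refl)
      (auto simp: rep_smult rep_quot_rep quot_rep_closed)
  finally show "rep (ce_diff br Q (quot_rep br I) n \<phi> ys) = \<dots>" .
qed

lemma rep_ce_diff_ideal_hom:
  assumes \<omega>: "\<omega> \<in> carrier (cochains n (ideal_hom I))" and len: "length ys = Suc n"
  shows "u \<in> I \<Longrightarrow> rep (ce_diff br (ideal_hom I) (hom_rep br I) n \<omega> ys u) =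
      (\<Sum>i\<le>n. (- 1) ^ i *\<^sub>R (p (br (ys ! i) (rep (\<omega> (nths ys (- {i})) u)))
         - rep (\<omega> (nths ys (- {i})) (br (ys ! i) u)))) +
      (\<Sum>(i, j)\<in>{(i, j). i < j \<and> j \<le> n}. (- 1) ^ (i + j) *\<^sub>R
        rep (\<omega> (br (ys ! i) (ys ! j) # nths ys (- {i, j})) u))"
    and "ce_diff br (ideal_hom I) (hom_rep br I) n \<omega> ys \<in> carrier (ideal_hom I)"
proof -
  note cl = cochain_omit_closed[OF \<omega> len]
  have 1: "(\<lambda>i. (- 1) ^ i \<odot>\<^bsub>ideal_hom I\<^esub> hom_rep br I (ys ! i) (\<omega> (nths ys (- {i}))))
      \<in> {..n} \<rightarrow> carrier (ideal_hom I)"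
    using cl by (auto intro!: ideal_hom_smult_closed hom_rep_closed)
  have 2: "(\<lambda>(i, j). (- 1) ^ (i + j) \<odot>\<^bsub>ideal_hom I\<^esub> \<omega> (br (ys ! i) (ys ! j) # nths ys (- {i, j})))
      \<in> {(i, j). i < j \<and> j \<le> n} \<rightarrow> carrier (ideal_hom I)"
    using cl by (auto intro!: ideal_hom_smult_closed)
  show "ce_diff br (ideal_hom I) (hom_rep br I) n \<omega> ys \<in> carrier (ideal_hom I)"
    using len 1 2 by (simp add: ce_diff_def H.finsum_closed)
  assume u: "u \<in> I"
  have "rep (ce_diff br (ideal_hom I) (hom_rep br I) n \<omega> ys u) =
      (\<Sum>i\<le>n. rep (((- 1) ^ i \<odot>\<^bsub>ideal_hom I\<^esub> hom_rep br I (ys ! i) (\<omega> (nths ys (- {i})))) u)) +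
      (\<Sum>z\<in>{(i, j). i < j \<and> j \<le> n}. rep ((case z of (i, j) \<Rightarrow>
        (- 1) ^ (i + j) \<odot>\<^bsub>ideal_hom I\<^esub> \<omega> (br (ys ! i) (ys ! j) # nths ys (- {i, j}))) u))"
    using len rep_ideal_hom_finsum[OF _ 1 u] rep_ideal_hom_finsum[OF finite_pairs 2 u] u
      ideal_hom_apply[OF H.finsum_closed[OF 1] u] ideal_hom_apply[OF H.finsum_closed[OF 2] u]
    by (simp add: ce_diff_def ideal_hom_sel(1) rep_add)
  also have "\<dots> = (\<Sum>i\<le>n. (- 1) ^ i *\<^sub>R (p (br (ys ! i) (rep (\<omega> (nths ys (- {i})) u)))
         - rep (\<omega> (nths ys (- {i})) (br (ys ! i) u)))) +
      (\<Sum>(i, j)\<in>{(i, j). i < j \<and> j \<le> n}. (- 1) ^ (i + j) *\<^sub>R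
        rep (\<omega> (br (ys ! i) (ys ! j) # nths ys (- {i, j})) u))"
    using cl u by (intro arg_cong2[of _ _ _ _ "(+)"] sum.cong refl)
      (auto simp: ideal_hom_sel(2) rep_smult rep_hom_rep hom_rep_closed ideal_hom_apply)
  finally show "rep (ce_diff br (ideal_hom I) (hom_rep br I) n \<omega> ys u) = \<dots>" .
qed

text \<open>
  Both differentials are compared on representatives: the terms \<open>?A\<close> come from the action on the
  quotient, \<open>?B\<close> from brackets with \<open>u\<close>, and \<open>?C\<close> from brackets of the other arguments.
\<close>

lemma Pi_map_ce_diff:
  assumes \<phi>: "\<phi> \<in> carrier (cochains (Suc k) Q)"
  shows "Pi_map I (Suc k)
      ((- 1) \<odot>\<^bsub>cochains (Suc (Suc k)) Q\<^esub> ce_diff br Q (quot_rep br I) (Suc k) \<phi>) =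
    ce_diff br (ideal_hom I) (hom_rep br I) k (Pi_map I k \<phi>)" (is "?l = ?r")
proof (rule extensionalityI[of _ "{xs. length xs = Suc k}"])
  fix xs :: "'g list" assume "xs \<in> {xs. length xs = Suc k}"
  then have len: "length xs = Suc k" by simp
  have alt: "alternating_map (Suc k) (\<lambda>xs. rep (\<phi> xs))"
    using \<phi> by (simp add: carrier_cochains_Q)
  note r = rep_ce_diff_ideal_hom[OF Pi_map_carrier[OF \<phi>] len]
  have "length (xs @ [v]) = Suc (Suc k)" for v
    by (simp add: len)
  note l = rep_ce_diff_Q[OF \<phi> this]
  have l_apply: "?l xs u = (- 1) ^ Suc (Suc k) \<odot>\<^bsub>Q\<^esub>
      ((- 1) \<odot>\<^bsub>Q\<^esub> ce_diff br Q (quot_rep br I) (Suc k) \<phi> (xs @ [u]))"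
    if "u \<in> I" for u
    using len that by (simp add: Pi_map_apply cochains_sel)
  show "?l xs = ?r xs"
  proof (rule ideal_hom_eqI)
    fix u assume u: "u \<in> I"
    let ?\<Phi> = "\<lambda>xs. rep (\<phi> xs)" and ?P = "{(i, j). i < j \<and> j \<le> k}"
    let ?A = "\<Sum>i\<le>k. (- 1) ^ i *\<^sub>R p (br (xs ! i) (?\<Phi> (nths xs (- {i}) @ [u])))"
    let ?B = "\<Sum>i\<le>k. (- 1) ^ i *\<^sub>R ?\<Phi> (nths xs (- {i}) @ [br (xs ! i) u])"
    let ?C = "\<Sum>(i, j)\<in>?P. (- 1) ^ (i + j) *\<^sub>R
        ?\<Phi> ((br (xs ! i) (xs ! j) # nths xs (- {i, j})) @ [u])"
    \<comment> \<open>The term in which \<open>u\<close> acts vanishes, since the ideal acts trivially on the quotient.\<close>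
    have "p (br u x) = 0" for x
      using br_ideal'[OF u] by (simp add: p_eq_0_iff)
    moreover have "(xs @ [u]) ! Suc k = u"
      by (simp flip: len)
    moreover have "(\<Sum>i\<le>k. (- 1) ^ i *\<^sub>R p (br ((xs @ [u]) ! i) (?\<Phi> (nths (xs @ [u]) (- {i}))))) =
        ?A"
      using len by (intro sum.cong refl) (simp add: nth_append nths_omit_snoc)
    ultimately have main: "rep (ce_diff br Q (quot_rep br I) (Suc k) \<phi> (xs @ [u])) = ?A - ?B + ?C"
      unfolding l(1) bracket_terms_snoc[OF alt len] using len by simp
    have "rep (?l xs u) = (- 1) ^ Suc k *\<^sub>R rep (ce_diff br Q (quot_rep br I) (Suc k) \<phi> (xs @ [u]))"
      using l(2) by (simp add: l_apply[OF u] rep_smult smult_closed)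
    also have "\<dots> = rep (?r xs u)"
    proof -
      have s: "rep (Pi_map I k \<phi> (nths xs (- {i})) v) =
          (- 1) ^ Suc k *\<^sub>R ?\<Phi> (nths xs (- {i}) @ [v])"
        if "i \<le> k" "v \<in> I" for i v
        using that len length_nths_omit[of "{i}" xs] rep_Pi_map[OF \<phi>] by simp
      have s': "rep (Pi_map I k \<phi> (x # nths xs (- {i, j})) u) =
          (- 1) ^ Suc k *\<^sub>R ?\<Phi> ((x # nths xs (- {i, j})) @ [u])"
        if "i < j" "j \<le> k" for i j x
        using that len length_nths_omit[of "{i, j}" xs] u by (subst rep_Pi_map[OF \<phi>]) auto
      have "rep (?r xs u) = (\<Sum>i\<le>k. (- 1) ^ Suc k *\<^sub>R ((- 1) ^ i *\<^sub>R
        (p (br (xs ! i) (?\<Phi> (nths xs (- {i}) @ [u])))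
         - ?\<Phi> (nths xs (- {i}) @ [br (xs ! i) u])))) +
        (\<Sum>(i, j)\<in>?P. (- 1) ^ Suc k *\<^sub>R ((- 1) ^ (i + j) *\<^sub>R
          ?\<Phi> ((br (xs ! i) (xs ! j) # nths xs (- {i, j})) @ [u])))"
        unfolding r(1)[OF u]
        using u br_ideal by (intro arg_cong2[of _ _ _ _ "(+)"] sum.cong refl)
          (auto simp: s s' scaleR_diff_right mult.commute simp del: power_Suc append_Cons)
      also have "\<dots> = (- 1) ^ Suc k *\<^sub>R (?A - ?B + ?C)"
        by (simp only: scaleR_sum_right scaleR_add_right scaleR_diff_right sum_subtractf
            case_prod_unfold)
      finally show ?thesis unfolding main by (rule sym)
    qed
    finally show "rep (?l xs u) = rep (?r xs u)" .
  qed (use len r(2) l(2) l_apply Pi_map_extensional in \<open>auto simp: carrier_ideal_hom smult_closed\<close>)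
qed (simp_all add: Pi_map_extensional ce_diff_def)

lemma cochain_map_Pi_map: "cochain_map (morphism_complex br I) (ideal_complex br I) (Pi_map I)"
  unfolding cochain_map_def morphism_complex_def ideal_complex_def shift_complex_def ce_complex_def
  using Pi_map_linear Pi_map_ce_diff by simp

end

section \<open>Calculus of smooth real functions\<close>

lemma deriv_cong_open:
  fixes f g :: "real \<Rightarrow> real"
  assumes "open J" "t \<in> J" "\<And>s. s \<in> J \<Longrightarrow> f s = g s"
  shows "deriv f t = deriv g t"
  by (rule deriv_cong_ev[OF _ refl]) (use assms in \<open>auto simp: eventually_nhds\<close>)

lemma higher_deriv_cong_open:
  fixes f g :: "real \<Rightarrow> real"
  assumes "open J" "\<And>s. s \<in> J \<Longrightarrow> f s = g s" "t \<in> J"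
  shows "(deriv ^^ n) f t = (deriv ^^ n) g t"
  using assms(3)
proof (induction n arbitrary: t)
  case (Suc n)
  then show ?case
    by (auto intro!: deriv_cong_open[OF assms(1)])
qed (use assms in auto)

lemma differentiable_cong_open:
  fixes f g :: "real \<Rightarrow> real"
  assumes "open J" "t \<in> J" "\<And>s. s \<in> J \<Longrightarrow> f s = g s"
  shows "f differentiable (at t) \<longleftrightarrow> g differentiable (at t)"
proof -
  have "f differentiable (at t)" if "g differentiable (at t)" "\<And>s. s \<in> J \<Longrightarrow> f s = g s"
    for f g :: "real \<Rightarrow> real"
    using that assms(1,2) unfolding differentiable_def
    by (metis has_derivative_transform_within_open)
  then show ?thesis
    using assms(3) by metis
qed

definition times_differentiable_on :: "nat \<Rightarrow> real set \<Rightarrow> (real \<Rightarrow> real) \<Rightarrow> bool" where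
  "times_differentiable_on n J f \<longleftrightarrow> (\<forall>m<n. \<forall>t\<in>J. (deriv ^^ m) f differentiable (at t))"

lemma smooth_iff_times_differentiable:
  "smooth_real_on J f \<longleftrightarrow> (\<forall>n. times_differentiable_on n J f)"
  unfolding smooth_real_on_def times_differentiable_on_def by auto

lemma times_differentiable_0 [simp]: "times_differentiable_on 0 J f"
  by (simp add: times_differentiable_on_def)

text \<open>This recursion lets the product and quotient rules be iterated by induction on the order.\<close>

lemma times_differentiable_Suc:
  "times_differentiable_on (Suc n) J f \<longleftrightarrow>
     (\<forall>t\<in>J. f differentiable (at t)) \<and> times_differentiable_on n J (deriv f)"
  unfolding times_differentiable_on_def
  by (auto simp: All_less_Suc2 funpow_swap1)

lemma times_differentiable_mono:
  "times_differentiable_on n J f \<Longrightarrow> m \<le> n \<Longrightarrow> times_differentiable_on m J f"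
  by (auto simp: times_differentiable_on_def)

lemma times_differentiable_cong:
  assumes "open J" "\<And>t. t \<in> J \<Longrightarrow> f t = g t" "times_differentiable_on n J g"
  shows "times_differentiable_on n J f"
  unfolding times_differentiable_on_def
proof (intro allI impI ballI)
  fix m t assume "m < n" "t \<in> J"
  then show "(deriv ^^ m) f differentiable (at t)"
    using assms higher_deriv_cong_open[OF assms(1,2)]
      differentiable_cong_open[OF assms(1) \<open>t \<in> J\<close>, of "(deriv ^^ m) f" "(deriv ^^ m) g"]
    by (auto simp: times_differentiable_on_def)
qed

lemma times_differentiable_const: "times_differentiable_on n J (\<lambda>_. c)"
proof (induction n arbitrary: c)
  case (Suc n)
  then show ?case by (simp only: times_differentiable_Suc deriv_const) simp
qed simp

lemma times_differentiable_add:
  assumes "open J" "times_differentiable_on n J f" "times_differentiable_on n J g"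
  shows "times_differentiable_on n J (\<lambda>t. f t + g t)"
  using assms(2,3)
proof (induction n arbitrary: f g)
  case (Suc n)
  then have d: "\<forall>t\<in>J. f differentiable (at t)" "\<forall>t\<in>J. g differentiable (at t)"
    and n: "times_differentiable_on n J (\<lambda>t. deriv f t + deriv g t)"
    by (auto simp: times_differentiable_Suc)
  have "times_differentiable_on n J (deriv (\<lambda>t. f t + g t))"
    using d by (intro times_differentiable_cong[OF assms(1) _ n])
      (auto simp: real_differentiable_def intro!: DERIV_imp_deriv derivative_eq_intros
        dest: DERIV_imp_deriv)
  with d show ?case by (auto simp: times_differentiable_Suc)
qed simp

lemma times_differentiable_mult:
  assumes "open J" "times_differentiable_on n J f" "times_differentiable_on n J g"
  shows "times_differentiable_on n J (\<lambda>t. f t * g t)"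
  using assms(2,3)
proof (induction n arbitrary: f g)
  case (Suc n)
  then have d: "\<forall>t\<in>J. f differentiable (at t)" "\<forall>t\<in>J. g differentiable (at t)"
    and n: "times_differentiable_on n J (\<lambda>t. f t * deriv g t + deriv f t * g t)"
    using times_differentiable_mono[OF Suc.prems(1), of n]
      times_differentiable_mono[OF Suc.prems(2), of n]
    by (auto simp: times_differentiable_Suc intro!: times_differentiable_add assms(1))
  have "times_differentiable_on n J (deriv (\<lambda>t. f t * g t))"
    using d by (intro times_differentiable_cong[OF assms(1) _ n])
      (auto simp: real_differentiable_def intro!: DERIV_imp_deriv derivative_eq_intros
        dest: DERIV_imp_deriv)
  with d show ?case by (auto simp: times_differentiable_Suc)
qed simp

lemma times_differentiable_inverse:
  assumes "open J" "times_differentiable_on n J f" "\<And>t. t \<in> J \<Longrightarrow> f t \<noteq> 0"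
  shows "times_differentiable_on n J (\<lambda>t. inverse (f t))"
  using assms(2)
proof (induction n)
  case (Suc n)
  then have d: "\<forall>t\<in>J. f differentiable (at t)"
    and n: "times_differentiable_on n J (\<lambda>t. (- 1) * (inverse (f t) * deriv f t * inverse (f t)))"
    using times_differentiable_mono[OF Suc.prems(1), of n] Suc.prems
    by (auto simp only: times_differentiable_Suc
        intro!: Suc.IH times_differentiable_mult times_differentiable_const assms(1))
  have "times_differentiable_on n J (deriv (\<lambda>t. inverse (f t)))"
    using d assms(3) by (intro times_differentiable_cong[OF assms(1) _ n])
      (auto simp: real_differentiable_def intro!: DERIV_imp_deriv derivative_eq_intros
        dest: DERIV_imp_deriv)
  with d assms(3) show ?case by (auto simp: times_differentiable_Suc)
qed simp

lemma smooth_const: "smooth_real_on J (\<lambda>_. c)"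
  by (simp add: smooth_iff_times_differentiable times_differentiable_const)

lemma smooth_add:
  "open J \<Longrightarrow> smooth_real_on J f \<Longrightarrow> smooth_real_on J g \<Longrightarrow> smooth_real_on J (\<lambda>t. f t + g t)"
  by (simp add: smooth_iff_times_differentiable times_differentiable_add)

lemma smooth_mult:
  "open J \<Longrightarrow> smooth_real_on J f \<Longrightarrow> smooth_real_on J g \<Longrightarrow> smooth_real_on J (\<lambda>t. f t * g t)"
  by (simp add: smooth_iff_times_differentiable times_differentiable_mult)

lemma smooth_inverse:
  "open J \<Longrightarrow> smooth_real_on J f \<Longrightarrow> (\<And>t. t \<in> J \<Longrightarrow> f t \<noteq> 0) \<Longrightarrow>
    smooth_real_on J (\<lambda>t. inverse (f t))"
  by (simp add: smooth_iff_times_differentiable times_differentiable_inverse)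

lemma smooth_cong:
  "open J \<Longrightarrow> (\<And>t. t \<in> J \<Longrightarrow> f t = g t) \<Longrightarrow> smooth_real_on J g \<Longrightarrow> smooth_real_on J f"
  unfolding smooth_iff_times_differentiable using times_differentiable_cong[of J f g] by blast

lemma smooth_subset: "smooth_real_on J f \<Longrightarrow> K \<subseteq> J \<Longrightarrow> smooth_real_on K f"
  by (auto simp: smooth_real_on_def)

lemma smooth_sum:
  assumes "open J" "\<And>i. i \<in> A \<Longrightarrow> smooth_real_on J (f i)"
  shows "smooth_real_on J (\<lambda>t. \<Sum>i\<in>A. f i t)"
  using assms(2) by (induction A rule: infinite_finite_induct)
    (simp_all add: smooth_const smooth_add[OF assms(1)])

lemma smooth_imp_isCont: "smooth_real_on J f \<Longrightarrow> t \<in> J \<Longrightarrow> isCont f t"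
  unfolding smooth_real_on_def
  by (metis differentiable_imp_continuous_within funpow_0)

section \<open>Smooth curves of vectors and of endomorphisms\<close>

definition smooth_vec_on :: "real set \<Rightarrow> (real \<Rightarrow> 'g::real_vector) \<Rightarrow> bool" where
  "smooth_vec_on J c \<longleftrightarrow> (\<forall>l. linear l \<longrightarrow> smooth_real_on J (\<lambda>t. l (c t)))"

definition smooth_endo_on :: "real set \<Rightarrow> (real \<Rightarrow> 'g::real_vector \<Rightarrow> 'g) \<Rightarrow> bool" where
  "smooth_endo_on J A \<longleftrightarrow> (\<forall>t\<in>J. linear (A t)) \<and> (\<forall>x. smooth_vec_on J (\<lambda>t. A t x))"

lemma smooth_vecD: "smooth_vec_on J c \<Longrightarrow> linear l \<Longrightarrow> smooth_real_on J (\<lambda>t. l (c t))"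
  by (simp add: smooth_vec_on_def)

lemma smooth_endoD:
  "smooth_endo_on J A \<Longrightarrow> smooth_vec_on J (\<lambda>t. A t x)"
  "smooth_endo_on J A \<Longrightarrow> t \<in> J \<Longrightarrow> linear (A t)"
  by (simp_all add: smooth_endo_on_def)

lemma smooth_vec_subset: "smooth_vec_on J c \<Longrightarrow> K \<subseteq> J \<Longrightarrow> smooth_vec_on K c"
  unfolding smooth_vec_on_def by (blast intro: smooth_subset)

lemma smooth_endo_subset: "smooth_endo_on J A \<Longrightarrow> K \<subseteq> J \<Longrightarrow> smooth_endo_on K A"
  unfolding smooth_endo_on_def by (blast intro: smooth_vec_subset)

text \<open>
  Coordinates in a finite basis reduce smoothness of vectors and endomorphisms to that of finitely
  many real functions.
\<close>

locale finite_basis =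
  fixes B :: "'g::real_vector set"
  assumes finite_B: "finite B" and independent_B: "independent B" and span_B: "span B = UNIV"
begin

definition coord :: "'g \<Rightarrow> 'g \<Rightarrow> real" where
  "coord b x = representation B x b"

lemma linear_coord: "linear (coord b)"
  unfolding coord_def
  by (intro linearI) (simp_all add: independent_B span_B representation_add representation_scale)

lemma sum_coord: "(\<Sum>b\<in>B. coord b x *\<^sub>R b) = x"
  unfolding coord_def
  using sum_representation_eq[OF independent_B _ finite_B subset_refl, of x] span_B by simp

lemma linear_expand:
  assumes "linear f" shows "f x = (\<Sum>b\<in>B. coord b x *\<^sub>R f b)"
proof -
  have "f x = f (\<Sum>b\<in>B. coord b x *\<^sub>R b)" by (simp only: sum_coord)
  also have "\<dots> = (\<Sum>b\<in>B. coord b x *\<^sub>R f b)"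
    by (simp only: linear_sum[OF assms] linear_cmul[OF assms])
  finally show ?thesis .
qed

lemma smooth_endo_apply:
  assumes "open J" "smooth_endo_on J A" "smooth_vec_on J c"
  shows "smooth_vec_on J (\<lambda>t. A t (c t) :: 'g)"
  unfolding smooth_vec_on_def
proof (intro allI impI)
  fix l :: "'g \<Rightarrow> real" assume l: "linear l"
  have "smooth_real_on J (\<lambda>t. coord b (c t) * l (A t b))" for b
    using smooth_mult[OF assms(1) smooth_vecD[OF assms(3) linear_coord]
        smooth_vecD[OF smooth_endoD(1)[OF assms(2)] l]] .
  then have sum: "smooth_real_on J (\<lambda>t. \<Sum>b\<in>B. coord b (c t) * l (A t b))"
    by (intro smooth_sum[OF assms(1)])
  have "l (A t (c t)) = (\<Sum>b\<in>B. coord b (c t) * l (A t b))" if "t \<in> J" for t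
  proof -
    have "linear (l \<circ> A t)"
      using linear_compose[OF smooth_endoD(2)[OF assms(2) that] l] .
    from linear_expand[OF this, of "c t"] show ?thesis by simp
  qed
  then show "smooth_real_on J (\<lambda>t. l (A t (c t)))"
    by (rule smooth_cong[OF assms(1) _ sum])
qed

text \<open>
  A product rule for a curve \<open>c\<close> of vectors with \<open>c s = 0\<close>: the derivative of \<open>A\<close> does not
  contribute.
\<close>

lemma has_derivative_endo_apply_at_zero:
  assumes A: "smooth_endo_on J A" and J: "open J" "s \<in> J"
    and c: "\<And>l::'g\<Rightarrow>real. linear l \<Longrightarrow> ((\<lambda>t. l (c t)) has_real_derivative l w) (at s)"
    and "c s = 0" and l: "linear l"
  shows "((\<lambda>t. l (A t (c t))) has_real_derivative l (A s w)) (at s)"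
proof -
  have lA: "linear (l \<circ> A t)" if "t \<in> J" for t
    using linear_compose[OF smooth_endoD(2)[OF A that] l] .
  have "((\<lambda>t. coord b (c t) * l (A t b)) has_real_derivative coord b w * l (A s b)) (at s)" for b
  proof -
    have "(\<lambda>t. l (A t b)) differentiable (at s)"
      using smooth_vecD[OF smooth_endoD(1)[OF A] l] J(2) unfolding smooth_real_on_def
      by (metis funpow_0)
    then obtain D where "((\<lambda>t. l (A t b)) has_real_derivative D) (at s)"
      by (auto simp: real_differentiable_def)
    from DERIV_mult[OF c[OF linear_coord[of b]] this] show ?thesis
      using \<open>c s = 0\<close> linear_0[OF linear_coord] by simp
  qed
  then have "((\<lambda>t. \<Sum>b\<in>B. coord b (c t) * l (A t b)) has_real_derivative
      (\<Sum>b\<in>B. coord b w * l (A s b))) (at s)"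
    by (intro DERIV_sum) auto
  moreover have "(\<Sum>b\<in>B. coord b w * l (A s b)) = l (A s w)"
    using linear_expand[OF lA[OF J(2)], of w] by simp
  ultimately show ?thesis
    using linear_expand[OF lA] J
    by (subst DERIV_cong_ev[OF refl _ refl, where g = "\<lambda>t. \<Sum>b\<in>B. coord b (c t) * l (A t b)"])
      (auto simp: eventually_nhds)
qed

text \<open>
  The Sherman--Morrison formula inverts a rank one perturbation of an invertible endomorphism.
  The denominator is \<open>1\<close> at \<open>s\<close>, where the perturbation vanishes, hence nonzero nearby.
\<close>

lemma smooth_inverse_rank_one:
  assumes e: "e > 0" and A: "smooth_endo_on {s - e<..<s + e} A"
    and L: "smooth_endo_on {s - e<..<s + e} L"
    and inv: "\<And>t x. t \<in> {s - e<..<s + e} \<Longrightarrow> L t (A t x) = x \<and> A t (L t x) = x"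
    and v: "smooth_vec_on {s - e<..<s + e} v" "v s = 0" and k: "linear (k :: 'g \<Rightarrow> real)"
  shows "\<exists>e'>0. e' \<le> e \<and> (\<exists>L'. smooth_endo_on {s - e'<..<s + e'} L' \<and>
    (\<forall>t\<in>{s - e'<..<s + e'}. \<forall>x. L' t (A t x + k x *\<^sub>R v t) = x \<and>
        A t (L' t x) + k (L' t x) *\<^sub>R v t = x))"
proof -
  let ?J = "{s - e<..<s + e}"
  define h where "h t = 1 + k (L t (v t))" for t
  have Lv: "smooth_vec_on ?J (\<lambda>t. L t (v t))"
    using smooth_endo_apply[OF _ L v(1)] by simp
  then have h: "smooth_real_on ?J h"
    unfolding h_def by (intro smooth_add smooth_const smooth_vecD k) auto
  have lin: "linear (L t)" "linear (A t)" if "t \<in> ?J" for t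
    using L A that by (auto simp: smooth_endo_on_def)
  have "h s = 1"
    using linear_0[OF lin(1)[of s]] linear_0[OF k] e v(2) by (simp add: h_def)
  moreover have "isCont h s"
    using h e by (intro smooth_imp_isCont) auto
  ultimately obtain d where d: "d > 0" "\<And>t. \<bar>t - s\<bar> < d \<Longrightarrow> h t \<noteq> 0"
    using continuous_at_avoid[of s h 0] by (auto simp: dist_real_def abs_minus_commute)
  define e' where "e' = min d e"
  let ?K = "{s - e'<..<s + e'}"
  have K: "?K \<subseteq> ?J" by (auto simp: e'_def)
  have h0: "h t \<noteq> 0" if "t \<in> ?K" for t
    using that by (intro d) (auto simp: e'_def)
  define L' where "L' t x = L t x - (k (L t x) * inverse (h t)) *\<^sub>R L t (v t)" for t x
  have "smooth_endo_on ?K L'"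
    unfolding smooth_endo_on_def smooth_vec_on_def
  proof (intro conjI ballI allI impI)
    fix t assume "t \<in> ?K"
    then have "linear (L t)" using K lin by blast
    then show "linear (L' t)" unfolding L'_def
      using k by (intro linearI)
       (simp_all add: linear_add linear_cmul algebra_simps)
  next
    fix x and l :: "'g \<Rightarrow> real" assume l: "linear l"
    have "smooth_real_on ?K (\<lambda>t. l (L t x))" "smooth_real_on ?K (\<lambda>t. k (L t x))"
      "smooth_real_on ?K (\<lambda>t. l (L t (v t)))" "smooth_real_on ?K h"
      using smooth_vecD[OF smooth_endoD(1)[OF L] l] smooth_vecD[OF smooth_endoD(1)[OF L] k]
        smooth_vecD[OF Lv l] h K
      by (auto intro: smooth_subset)
    then have "smooth_real_on ?K (\<lambda>t. l (L t x) +
        (- 1) * ((k (L t x) * inverse (h t)) * l (L t (v t))))"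
      using h0 by (intro smooth_add smooth_mult smooth_inverse smooth_const) auto
    then show "smooth_real_on ?K (\<lambda>t. l (L' t x))"
      by (simp add: L'_def linear_diff[OF l] linear_cmul[OF l])
  qed
  moreover have "L' t (A t x + k x *\<^sub>R v t) = x \<and> A t (L' t x) + k (L' t x) *\<^sub>R v t = x"
    if t: "t \<in> ?K" for t x
  proof -
    have tJ: "t \<in> ?J" using t K by blast
    let ?y = "L t (v t)"
    have h': "k ?y = h t - 1" by (simp add: h_def)
    have kx: "k (L' t x) = k (L t x) * inverse (h t)"
      using h0[OF t] by (simp add: L'_def linear_diff[OF k] linear_cmul[OF k] h' field_simps)
    have "L t (A t x + k x *\<^sub>R v t) = x + k x *\<^sub>R ?y"
      using inv[OF tJ] lin(1)[OF tJ] by (simp add: linear_add linear_cmul)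
    moreover from this have "k (L t (A t x + k x *\<^sub>R v t)) * inverse (h t) = k x"
      using h0[OF t] by (simp add: linear_add[OF k] linear_cmul[OF k] h' field_simps)
    moreover have "A t (L' t x) = x - (k (L t x) * inverse (h t)) *\<^sub>R v t"
      using inv[OF tJ] lin(2)[OF tJ] by (simp add: L'_def linear_diff linear_cmul)
    ultimately show ?thesis
      by (simp add: kx) (simp add: L'_def)
  qed
  ultimately show ?thesis
    using d(1) e by (intro exI[of _ e']) (auto simp: e'_def)
qed

text \<open>
  \<open>N t\<close> is the identity plus the rank one maps \<open>x \<mapsto> coord b x *\<^sub>R (N t b - b)\<close> for \<open>b\<close> in the
  basis, all of which vanish at \<open>s\<close>; they are added one at a time.
\<close>

lemma smooth_inverse_near_identity:
  fixes N :: "real \<Rightarrow> 'g \<Rightarrow> 'g"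
  assumes e: "e > 0" and N: "smooth_endo_on {s - e<..<s + e} N" and "\<And>x. N s x = x"
  shows "\<exists>e'>0. e' \<le> e \<and> (\<exists>L. smooth_endo_on {s - e'<..<s + e'} L \<and>
    (\<forall>t\<in>{s - e'<..<s + e'}. \<forall>x. L t (N t x) = x \<and> N t (L t x) = x))"
proof -
  define v where "v b t = N t b - b" for b t
  define A where "A F t x = x + (\<Sum>b\<in>F. coord b x *\<^sub>R v b t)" for F t x
  have v_smooth: "smooth_vec_on {s - e<..<s + e} (v b)" for b
    unfolding smooth_vec_on_def
  proof (intro allI impI)
    fix l :: "'g \<Rightarrow> real" assume l: "linear l"
    then have "smooth_real_on {s - e<..<s + e} (\<lambda>t. l (N t b) + (- l b))"
      by (intro smooth_add smooth_const smooth_vecD smooth_endoD(1)[OF N]) auto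
    then show "smooth_real_on {s - e<..<s + e} (\<lambda>t. l (v b t))"
      by (simp add: v_def linear_diff[OF l])
  qed
  have A_smooth: "smooth_endo_on {s - e<..<s + e} (A F)" for F
    unfolding smooth_endo_on_def smooth_vec_on_def
  proof (intro conjI ballI allI impI)
    fix t show "linear (A F t)"
      unfolding A_def
      by (intro linearI) (simp_all add: linear_add[OF linear_coord] linear_cmul[OF linear_coord]
          scaleR_add_left sum.distrib scaleR_sum_right scaleR_add_right)
  next
    fix x and l :: "'g \<Rightarrow> real" assume l: "linear l"
    then have "smooth_real_on {s - e<..<s + e} (\<lambda>t. l x + (\<Sum>b\<in>F. coord b x * l (v b t)))"
      by (intro smooth_add smooth_sum smooth_mult smooth_const smooth_vecD v_smooth) auto
    then show "smooth_real_on {s - e<..<s + e} (\<lambda>t. l (A F t x))"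
      by (simp add: A_def linear_add[OF l] linear_sum[OF l] linear_cmul[OF l])
  qed
  have "\<exists>e'>0. e' \<le> e \<and> (\<exists>L. smooth_endo_on {s - e'<..<s + e'} L \<and>
    (\<forall>t\<in>{s - e'<..<s + e'}. \<forall>x. L t (A F t x) = x \<and> A F t (L t x) = x))" if "finite F" for F
    using that
  proof (induction F rule: finite_induct)
    case empty
    have "smooth_endo_on {s - e<..<s + e} (\<lambda>t x. x)"
      by (auto simp: smooth_endo_on_def smooth_vec_on_def intro!: linear_ident smooth_const)
    then show ?case
      using e by (intro exI[of _ e]) (auto simp: A_def intro!: exI[of _ "\<lambda>t x. x"])
  next
    case (insert b F)
    then obtain e1 L where 1: "e1 > 0" "e1 \<le> e" "smooth_endo_on {s - e1<..<s + e1} L"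
      "\<And>t x. t \<in> {s - e1<..<s + e1} \<Longrightarrow> L t (A F t x) = x \<and> A F t (L t x) = x"
      by blast
    have sub: "{s - e1<..<s + e1} \<subseteq> {s - e<..<s + e}" using 1 by auto
    have "smooth_endo_on {s - e1<..<s + e1} (A F)" "smooth_vec_on {s - e1<..<s + e1} (v b)"
      using A_smooth[of F] v_smooth[of b] sub by (auto intro: smooth_endo_subset smooth_vec_subset)
    moreover have "v b s = 0" by (simp add: v_def assms(3))
    ultimately obtain e2 L' where 2: "e2 > 0" "e2 \<le> e1" "smooth_endo_on {s - e2<..<s + e2} L'"
      "\<And>t x. t \<in> {s - e2<..<s + e2} \<Longrightarrow> L' t (A F t x + coord b x *\<^sub>R v b t) = x \<and>
         A F t (L' t x) + coord b (L' t x) *\<^sub>R v b t = x"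
      using smooth_inverse_rank_one[OF 1(1) _ 1(3,4) _ _ linear_coord[of b], where v="v b"] by blast
    have "A (insert b F) t x = A F t x + coord b x *\<^sub>R v b t" for t x
      using insert by (simp add: A_def)
    then show ?case
      using 1(2) 2 by (intro exI[of _ e2]) (auto intro!: exI[of _ L'])
  qed
  from this[OF finite_B] obtain e' L where L: "e' > 0" "e' \<le> e"
      "smooth_endo_on {s - e'<..<s + e'} L"
      "\<And>t x. t \<in> {s - e'<..<s + e'} \<Longrightarrow> L t (A B t x) = x \<and> A B t (L t x) = x"
    by blast
  have "A B t x = N t x" if "t \<in> {s - e'<..<s + e'}" for t x
  proof -
    have "linear (N t)" using N that L(2) by (auto simp: smooth_endo_on_def)
    from linear_expand[OF this, of x] sum_coord[of x] show ?thesis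
      by (simp add: A_def v_def scaleR_diff_right sum_subtractf)
  qed
  then show ?thesis
    using L by (intro exI[of _ e']) (auto intro!: exI[of _ L])
qed

end

section \<open>Curves of linear maps between subspaces\<close>

lemma exists_projection_onto:
  fixes S :: "'g::real_vector set"
  assumes "subspace S"
  shows "\<exists>p. linear p \<and> (\<forall>x. p x \<in> S) \<and> (\<forall>x\<in>S. p x = x)"
  using linear_exists_left_inverse_on[OF linear_ident assms] by (auto simp: inj_on_def)

lemma carrier_hom_subspaces:
  assumes "subspace W" "subspace C"
  shows "f \<in> carrier (hom_space (subspace_module W) (subspace_module C)) \<longleftrightarrow>
    f \<in> extensional W \<and> f \<in> W \<rightarrow> C \<and> (\<forall>x\<in>W. \<forall>y\<in>W. f (x + y) = f x + f y) \<and>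
    (\<forall>c. \<forall>x\<in>W. f (c *\<^sub>R x) = c *\<^sub>R f x)"
  by (auto simp: hom_space_sel lin_maps_def)

lemma linear_restrict_hom:
  assumes "subspace W" "subspace C" "linear f" "\<And>u. u \<in> W \<Longrightarrow> f u \<in> C"
  shows "(\<lambda>u\<in>W. f u) \<in> carrier (hom_space (subspace_module W) (subspace_module C))"
  using assms
  by (auto simp: carrier_hom_subspaces subspace_add subspace_scale linear_add linear_cmul)

lemma hom_functional_sum:
  fixes W C :: "'g::real_vector set"
  assumes sub: "subspace W" "subspace C"
    and l: "l \<in> lin_maps (hom_space (subspace_module W) (subspace_module C))
      (subspace_module (UNIV :: real set))"
    and "finite K"
    and E: "\<And>k. k \<in> K \<Longrightarrow> E k \<in> carrier (hom_space (subspace_module W) (subspace_module C))"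
  shows "l (\<lambda>u\<in>W. \<Sum>k\<in>K. a k *\<^sub>R E k u) = (\<Sum>k\<in>K. a k * l (E k)) \<and>
    (\<lambda>u\<in>W. \<Sum>k\<in>K. a k *\<^sub>R E k u) \<in> carrier (hom_space (subspace_module W) (subspace_module C))"
proof -
  let ?H = "hom_space (subspace_module W) (subspace_module C)"
  have l_add: "l (f \<oplus>\<^bsub>?H\<^esub> g) = l f + l g" if "f \<in> carrier ?H" "g \<in> carrier ?H" for f g
    using l that unfolding lin_maps_def by simp
  have l_smult: "l (c \<odot>\<^bsub>?H\<^esub> f) = c * l f" if "f \<in> carrier ?H" for c f
    using l that unfolding lin_maps_def by simp
  show ?thesis
    using \<open>finite K\<close> E
  proof (induction K rule: finite_induct)
    case empty
    have zero: "(\<lambda>u\<in>W. 0) \<in> carrier ?H"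
      using sub by (simp add: carrier_hom_subspaces subspace_0 subspace_add subspace_scale)
    have "(\<lambda>u\<in>W. 0) \<oplus>\<^bsub>?H\<^esub> (\<lambda>u\<in>W. 0) = (\<lambda>u\<in>W. 0)"
      by (simp add: hom_space_sel cong: restrict_cong)
    then have "l (\<lambda>u\<in>W. 0) = 0"
      using l_add[OF zero zero] by simp
    with zero show ?case by (simp only: sum.empty simp_thms)
  next
    case (insert k K)
    let ?s = "\<lambda>u\<in>W. \<Sum>k\<in>K. a k *\<^sub>R E k u"
    have "l ?s = (\<Sum>k\<in>K. a k * l (E k)) \<and> ?s \<in> carrier ?H"
      by (rule insert.IH) (rule insert.prems[OF insertI2])
    then have s: "?s \<in> carrier ?H" and ls: "l ?s = (\<Sum>k\<in>K. a k * l (E k))"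
      by (rule conjunct2, rule conjunct1)
    have Ek: "E k \<in> carrier ?H" using insert.prems by simp
    have aE: "a k \<odot>\<^bsub>?H\<^esub> E k \<in> carrier ?H"
      using Ek unfolding carrier_hom_subspaces[OF sub] hom_space_sel(3)
      by (simp add: Pi_iff subspace_add[OF sub(1)] subspace_scale[OF sub(1)]
        subspace_scale[OF sub(2)]
          scaleR_add_right)
    have sum: "(a k \<odot>\<^bsub>?H\<^esub> E k) \<oplus>\<^bsub>?H\<^esub> ?s \<in> carrier ?H"
      using aE s unfolding carrier_hom_subspaces[OF sub] hom_space_sel(2)
      by (simp add: Pi_iff subspace_add[OF sub(1)] subspace_scale[OF sub(1)] subspace_add[OF sub(2)]
          scaleR_add_right)
    have eq: "(\<lambda>u\<in>W. \<Sum>k\<in>insert k K. a k *\<^sub>R E k u) = (a k \<odot>\<^bsub>?H\<^esub> E k) \<oplus>\<^bsub>?H\<^esub> ?s"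
      using insert.hyps by (simp add: hom_space_sel cong: restrict_cong)
    show ?case
      unfolding eq using insert.hyps sum by (simp add: l_add[OF aE s] l_smult[OF Ek] ls)
  qed
qed

context finite_basis
begin

text \<open>
  A functional on \<open>Hom(W, C)\<close> is a combination of finitely many matrix entries. Hence smoothness
  and velocity of a curve in \<open>Hom(W, C)\<close> can be tested on the values at single vectors.
\<close>

lemma hom_functional_expand:
  assumes sub: "subspace (W :: 'g set)" "subspace (C :: 'g set)"
  shows "\<exists>E x. (\<forall>b\<in>B. x b \<in> W) \<and>
    (\<forall>l\<in>lin_maps (hom_space (subspace_module W) (subspace_module C))
      (subspace_module (UNIV :: real set)).
     \<forall>f\<in>carrier (hom_space (subspace_module W) (subspace_module C)).
       l f = (\<Sum>(b, c)\<in>B \<times> B. coord c (f (x b)) * l (E b c)))"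
proof -
  let ?H = "hom_space (subspace_module W) (subspace_module C)"
  \<comment> \<open>The vectors of the basis need not lie in \<open>W\<close> or \<open>C\<close>; the projections \<open>p\<close>
      and \<open>q\<close> move them there.\<close>
  obtain p where p: "linear p" "\<And>x. p x \<in> W" "\<And>x. x \<in> W \<Longrightarrow> p x = x"
    using exists_projection_onto[OF sub(1)] by blast
  obtain q where q: "linear q" "\<And>x. q x \<in> C" "\<And>x. x \<in> C \<Longrightarrow> q x = x"
    using exists_projection_onto[OF sub(2)] by blast
  define E where "E b c = (\<lambda>u\<in>W. coord b u *\<^sub>R q c)" for b c
  have E: "E b c \<in> carrier ?H" for b c
    unfolding E_def
    by (rule linear_restrict_hom[OF sub])
      (auto intro!: linearI subspace_scale[OF sub(2)] q
        simp: linear_add[OF linear_coord] linear_cmul[OF linear_coord] scaleR_add_left)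
  have "f = (\<lambda>u\<in>W. \<Sum>k\<in>B \<times> B. coord (snd k) (f (p (fst k))) *\<^sub>R E (fst k) (snd k) u)"
    if f: "f \<in> carrier ?H" for f
  proof (rule extensionalityI[of _ W])
    fix u assume u: "u \<in> W"
    have f': "f \<in> W \<rightarrow> C" "\<And>x y. x \<in> W \<Longrightarrow> y \<in> W \<Longrightarrow> f (x + y) = f x + f y"
      "\<And>c x. x \<in> W \<Longrightarrow> f (c *\<^sub>R x) = c *\<^sub>R f x"
      using f by (auto simp: carrier_hom_subspaces[OF sub])
    have "linear (\<lambda>x. f (p x))"
      using f' p by (intro linearI) (simp_all add: linear_add linear_cmul)
    then have "f (p u) = (\<Sum>b\<in>B. coord b u *\<^sub>R f (p b))"
      by (rule linear_expand)
    also have "\<dots> = (\<Sum>b\<in>B. coord b u *\<^sub>R (\<Sum>c\<in>B. coord c (f (p b)) *\<^sub>R q c))"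
    proof (intro sum.cong refl arg_cong2[of _ _ _ _ scaleR])
      fix b
      have "f (p b) \<in> C" using f'(1) p(2) by blast
      then have "f (p b) = q (f (p b))" using q(3) by simp
      also have "\<dots> = (\<Sum>c\<in>B. coord c (f (p b)) *\<^sub>R q c)"
        by (rule linear_expand[OF q(1)])
      finally show "f (p b) = (\<Sum>c\<in>B. coord c (f (p b)) *\<^sub>R q c)" .
    qed
    also have "\<dots> = (\<Sum>k\<in>B \<times> B. coord (snd k) (f (p (fst k))) *\<^sub>R E (fst k) (snd k) u)"
      using u by (simp add: E_def sum.cartesian_product' scaleR_sum_right mult.commute)
    finally show "f u = (\<lambda>u\<in>W. \<Sum>k\<in>B \<times> B. coord (snd k) (f (p (fst k))) *\<^sub>R E (fst k) (snd k) u) u"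
      using u p by simp
  qed (use f in \<open>auto simp: carrier_hom_subspaces[OF sub]\<close>)
  note expand = this
  have "l f = (\<Sum>(b, c)\<in>B \<times> B. coord c (f (p b)) * l (E b c))"
    if "f \<in> carrier ?H" "l \<in> lin_maps ?H (subspace_module (UNIV :: real set))" for f l
  proof -
    have "l (\<lambda>u\<in>W. \<Sum>k\<in>B \<times> B. coord (snd k) (f (p (fst k))) *\<^sub>R E (fst k) (snd k) u) =
        (\<Sum>k\<in>B \<times> B. coord (snd k) (f (p (fst k))) * l (E (fst k) (snd k)))"
      using hom_functional_sum[OF sub that(2), of "B \<times> B"
        "\<lambda>k. E (fst k) (snd k)"] E finite_B by simp
    with expand[OF that(1)] show ?thesis
      by (simp add: case_prod_unfold)
  qed
  then show ?thesis
    using p(2) by blast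
qed

lemma smooth_curve_homI:
  assumes sub: "subspace (W :: 'g set)" "subspace (C :: 'g set)" and J: "open J"
    and f: "\<And>t. t \<in> J \<Longrightarrow> f t \<in> carrier (hom_space (subspace_module W) (subspace_module C))"
    and sm: "\<And>u. u \<in> W \<Longrightarrow> smooth_vec_on J (\<lambda>t. f t u)"
  shows "smooth_curve_on (hom_space (subspace_module W) (subspace_module C)) J f"
  unfolding smooth_curve_on_def
proof (intro conjI ballI f)
  fix l :: "('g \<Rightarrow> 'g) \<Rightarrow> real"
  assume l: "l \<in> lin_maps (hom_space (subspace_module W) (subspace_module C))
      (subspace_module UNIV)"
  obtain E x where x: "\<And>b. b \<in> B \<Longrightarrow> x b \<in> W" and
    ex: "\<And>t. t \<in> J \<Longrightarrow> l (f t) = (\<Sum>(b, c)\<in>B \<times> B. coord c (f t (x b)) * l (E b c))"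
    using hom_functional_expand[OF sub] l f by blast
  have "smooth_real_on J (\<lambda>t. \<Sum>k\<in>B \<times> B. coord (snd k) (f t (x (fst k))) * l (E (fst k) (snd k)))"
    by (intro smooth_sum smooth_mult J smooth_const smooth_vecD[OF sm linear_coord]) (auto simp: x)
  then show "smooth_real_on J (\<lambda>t. l (f t))"
    by (rule smooth_cong[OF J, rotated]) (simp add: ex case_prod_unfold)
qed

lemma has_velocity_homI:
  assumes sub: "subspace (W :: 'g set)" "subspace (C :: 'g set)" and J: "open J" "s \<in> J"
    and f: "\<And>t. t \<in> J \<Longrightarrow> f t \<in> carrier (hom_space (subspace_module W) (subspace_module C))"
    and v: "v \<in> carrier (hom_space (subspace_module W) (subspace_module C))"
    and d: "\<And>u m. u \<in> W \<Longrightarrow> linear m \<Longrightarrow> ((\<lambda>t. m (f t u)) has_real_derivative m (v u)) (at s)"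
  shows "has_velocity (hom_space (subspace_module W) (subspace_module C)) f v s"
  unfolding has_velocity_def
proof (intro conjI ballI v)
  fix l :: "('g \<Rightarrow> 'g) \<Rightarrow> real"
  assume l: "l \<in> lin_maps (hom_space (subspace_module W) (subspace_module C))
      (subspace_module UNIV)"
  obtain E x where x: "\<And>b. b \<in> B \<Longrightarrow> x b \<in> W" and
    ex: "\<And>g. g \<in> carrier (hom_space (subspace_module W) (subspace_module C)) \<Longrightarrow>
      l g = (\<Sum>(b, c)\<in>B \<times> B. coord c (g (x b)) * l (E b c))"
    using hom_functional_expand[OF sub] l by blast
  have "((\<lambda>t. \<Sum>k\<in>B \<times> B. coord (snd k) (f t (x (fst k))) * l (E (fst k) (snd k)))
      has_real_derivative (\<Sum>k\<in>B \<times> B. coord (snd k) (v (x (fst k))) * l (E (fst k) (snd k)))) (at s)"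
    by (intro DERIV_sum DERIV_cmult_right d linear_coord) (auto simp: x)
  then have "((\<lambda>t. \<Sum>k\<in>B \<times> B. coord (snd k) (f t (x (fst k))) * l (E (fst k) (snd k)))
      has_real_derivative l v) (at s)"
    by (simp add: ex[OF v] case_prod_unfold)
  then show "((\<lambda>t. l (f t)) has_real_derivative l v) (at s)"
    by (rule has_field_derivative_transform_within_open[OF _ J])
      (simp add: ex[OF f] case_prod_unfold)
qed

section \<open>Kernels of a smooth curve of surjections\<close>

text \<open>
  Let \<open>\<sigma>\<close> be a linear section of \<open>Q s\<close>. The endomorphism \<open>N t = Q t \<sigma> p + 1 - p\<close> is the identity at
  \<open>s\<close>, and its inverse \<open>L t\<close> restricts to the inverse of \<open>Q t \<sigma>\<close> on the range of \<open>p\<close>. So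
  \<open>u + \<phi> u\<close> with \<open>\<phi> u\<close> in \<open>\<sigma> ` range p\<close> lies in the kernel of \<open>Q t\<close> exactly if
  \<open>\<phi> u = - \<sigma> (L t (Q t u))\<close>, and the kernels form a smooth curve in the Grassmannian.
\<close>

lemma kernel_chart:
  fixes Q :: "real \<Rightarrow> 'g \<Rightarrow> 'g"
  assumes J: "open J" "s \<in> J" and Q: "smooth_endo_on J Q"
    and p: "linear p" "\<And>x. p (p x) = p x" and pQ: "\<And>t x. t \<in> J \<Longrightarrow> p (Q t x) = Q t x"
    and surj: "\<And>x. \<exists>y. Q s y = p x"
  obtains e \<sigma> L where "e > 0" "{s - e<..<s + e} \<subseteq> J" "linear \<sigma>" "smooth_endo_on {s - e<..<s + e} L"
    "\<And>x. L s x = x" "\<And>x. Q s (\<sigma> (p x)) = p x"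
    "\<And>t x. t \<in> {s - e<..<s + e} \<Longrightarrow> p (L t (p x)) = L t (p x)"
    "\<And>t x. t \<in> {s - e<..<s + e} \<Longrightarrow> Q t (\<sigma> (L t (p x))) = p x"
    "smooth_chart_at (\<lambda>t. {x. Q t x = 0}) s (\<sigma> ` range p)
      (\<lambda>t. \<lambda>u\<in>{x. Q s x = 0}. - \<sigma> (L t (Q t u)))"
proof -
  have lQ: "linear (Q t)" if "t \<in> J" for t
    using Q that by (rule smooth_endoD)
  obtain \<sigma> where \<sigma>: "linear \<sigma>" "\<And>x. x \<in> range (Q s) \<Longrightarrow> Q s (\<sigma> x) = x"
    using linear_exists_right_inverse_on[OF lQ[OF J(2)] subspace_UNIV] by blast
  have Q\<sigma>: "Q s (\<sigma> (p x)) = p x" for x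
    using surj[of x] by (metis \<sigma>(2) rangeI)
  obtain d where d: "d > 0" "{s - d<..<s + d} \<subseteq> J"
    using J unfolding open_contains_ball by (metis ball_eq_greaterThanLessThan)
  define N where "N t x = Q t (\<sigma> (p x)) + (x - p x)" for t x
  have N: "smooth_endo_on {s - d<..<s + d} N"
    unfolding smooth_endo_on_def smooth_vec_on_def
  proof (intro conjI ballI allI impI)
    fix t assume "t \<in> {s - d<..<s + d}"
    then have "linear (Q t)" using d lQ by blast
    then show "linear (N t)"
      unfolding N_def by (intro linearI) (simp_all add: linear_add
          linear_cmul \<sigma>(1) p(1) algebra_simps)
  next
    fix x and l :: "'g \<Rightarrow> real" assume l: "linear l"
    have "smooth_real_on {s - d<..<s + d} (\<lambda>t. l (Q t (\<sigma> (p x))) + l (x - p x))"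
      by (intro smooth_add smooth_const smooth_vecD[OF _ l]
        smooth_endoD(1)[OF smooth_endo_subset[OF Q d(2)]]) auto
    then show "smooth_real_on {s - d<..<s + d} (\<lambda>t. l (N t x))"
      by (simp add: N_def linear_add[OF l])
  qed
  have "N s x = x" for x by (simp add: N_def Q\<sigma>)
  then obtain e L where e: "e > 0" "e \<le> d" and L: "smooth_endo_on {s - e<..<s + e} L"
    and LN: "\<And>t x. t \<in> {s - e<..<s + e} \<Longrightarrow> L t (N t x) = x"
    and NL: "\<And>t x. t \<in> {s - e<..<s + e} \<Longrightarrow> N t (L t x) = x"
    using smooth_inverse_near_identity[OF d(1) N] by blast
  let ?K = "{s - e<..<s + e}"
  have K: "?K \<subseteq> J" "s \<in> ?K" using d e by auto
  have Ls: "L s x = x" for x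
    using LN[OF K(2), of x] \<open>\<And>x. N s x = x\<close> by simp
  have lL: "linear (L t)" if "t \<in> ?K" for t
    using L that by (rule smooth_endoD)
  have pL: "p (L t (p x)) = L t (p x)" if t: "t \<in> ?K" for t x
  proof -
    \<comment> \<open>For \<open>y = L t (p x)\<close>, applying \<open>p\<close> to \<open>N t y = p x\<close> gives \<open>Q t (\<sigma> (p y)) = p x\<close>, which leaves
      \<open>y - p y = 0\<close>.\<close>
    let ?y = "L t (p x)"
    have "p (N t ?y) = Q t (\<sigma> (p ?y))"
      using t K by (simp add: N_def linear_add[OF p(1)] linear_diff[OF p(1)] p(2) pQ subsetD)
    then have "p x = Q t (\<sigma> (p ?y))"
      using NL[OF t, of "p x"] by (simp add: p(2))
    with NL[OF t, of "p x"] show ?thesis by (simp add: N_def)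
  qed
  have Q\<sigma>L: "Q t (\<sigma> (L t (p x))) = p x" if t: "t \<in> ?K" for t x
    using NL[OF t, of "p x"] by (simp add: N_def pL[OF t])
  let ?W = "\<lambda>t. {x. Q t x = 0}" and ?C = "\<sigma> ` range p"
  let ?\<phi> = "\<lambda>t. \<lambda>u\<in>?W s. - \<sigma> (L t (Q t u))"
  have QL: "L t (Q t u) = p (L t (Q t u))" if "t \<in> ?K" for t u
    using pL[OF that, of "Q t u"] that K pQ by (simp add: subsetD)
  have sub_W: "subspace (?W s)"
    using lQ[OF J(2)] by (simp add: subspace_def linear_0 linear_add linear_cmul)
  have sub_C: "subspace ?C"
    by (intro linear_subspace_image \<sigma> p subspace_UNIV)
  have comp: "complement (?W s) ?C"
    unfolding complement_def
  proof (intro conjI sub_C)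
    have "x = 0" if "Q s x = 0" "x = \<sigma> (p y)" for x y
      using that Q\<sigma>[of y] linear_0[OF \<sigma>(1)] by simp
    then show "?W s \<inter> ?C = {0}"
      using subspace_0[OF sub_W] subspace_0[OF sub_C] by auto
    have "x \<in> {w + c |w c. w \<in> ?W s \<and> c \<in> ?C}" for x
    proof -
      have "Q s (\<sigma> (Q s x)) = Q s x" using \<sigma>(2) by simp
      then have "x - \<sigma> (Q s x) \<in> ?W s" by (simp add: linear_diff[OF lQ[OF J(2)]])
      moreover have "\<sigma> (Q s x) \<in> ?C"
        using pQ[OF J(2), of x] by (metis imageI rangeI)
      moreover have "x = (x - \<sigma> (Q s x)) + \<sigma> (Q s x)" by simp
      ultimately show ?thesis by blast
    qed
    then show "{w + c |w c. w \<in> ?W s \<and> c \<in> ?C} = UNIV" by blast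
  qed
  have \<sigma>LQ_mem: "- \<sigma> (L t (Q t u)) \<in> ?C" if "t \<in> ?K" for t u
    using QL[OF that, of u] subspace_neg[OF sub_C] by (metis imageI rangeI)
  have lin: "linear (\<lambda>u. - \<sigma> (L t (Q t u)))" if "t \<in> ?K" for t
    using lQ lL[OF that] that K \<sigma>(1)
    by (intro linearI) (auto simp: linear_add linear_cmul subsetD)
  have smooth: "smooth_curve_on (hom_space (subspace_module (?W s)) (subspace_module ?C)) ?K ?\<phi>"
  proof (rule smooth_curve_homI[OF sub_W sub_C])
    fix t assume "t \<in> ?K"
    then show "?\<phi> t \<in> carrier (hom_space (subspace_module (?W s)) (subspace_module ?C))"
      by (intro linear_restrict_hom sub_W sub_C lin \<sigma>LQ_mem)
  next
    fix u assume u: "u \<in> ?W s"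
    show "smooth_vec_on ?K (\<lambda>t. ?\<phi> t u)"
      unfolding smooth_vec_on_def
    proof (intro allI impI)
      fix l :: "'g \<Rightarrow> real" assume l: "linear l"
      have "linear (\<lambda>x. l (- \<sigma> x))"
        using l \<sigma>(1) by (intro linearI) (simp_all add: linear_add linear_cmul linear_diff
          linear_neg)
      moreover have "smooth_vec_on ?K (\<lambda>t. L t (Q t u))"
        by (rule smooth_endo_apply[OF _ L smooth_vec_subset[OF smooth_endoD(1)[OF Q] K(1)]]) simp
      ultimately have "smooth_real_on ?K (\<lambda>t. l (- \<sigma> (L t (Q t u))))"
        using smooth_vecD by blast
      then show "smooth_real_on ?K (\<lambda>t. l (?\<phi> t u))"
        using u by simp
    qed
  qed simp
  have graph: "?W t = {u + ?\<phi> t u |u. u \<in> ?W s}" if t: "t \<in> ?K" for t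
  proof (intro equalityI subsetI)
    have tJ: "t \<in> J" using t K by blast
    fix x assume "x \<in> {u + ?\<phi> t u |u. u \<in> ?W s}"
    then obtain u where "x = u - \<sigma> (L t (Q t u))" by auto
    then show "x \<in> ?W t"
      using Q\<sigma>L[OF t, of "Q t u"] by (simp add: linear_diff[OF lQ[OF tJ]] pQ[OF tJ])
  next
    have tJ: "t \<in> J" using t K by blast
    fix x assume x: "x \<in> ?W t"
    let ?c = "Q s x" and ?u = "x - \<sigma> (Q s x)"
    have c: "p ?c = ?c" using pQ[OF J(2)] .
    have u: "?u \<in> ?W s"
      using \<sigma>(2)[of ?c] by (simp add: linear_diff[OF lQ[OF J(2)]])
    have "L t (Q t (\<sigma> ?c)) = ?c"
      using LN[OF t, of ?c] by (simp add: N_def c)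
    moreover have "Q t ?u = - Q t (\<sigma> ?c)"
      using x by (simp add: linear_diff[OF lQ[OF tJ]])
    ultimately have "- \<sigma> (L t (Q t ?u)) = \<sigma> ?c"
      by (simp add: linear_neg[OF lL[OF t]] linear_neg[OF \<sigma>(1)])
    then have "x = ?u + ?\<phi> t ?u"
      using u by simp
    then show "x \<in> {u + ?\<phi> t u |u. u \<in> ?W s}"
      using u by blast
  qed
  have "smooth_chart_at ?W s ?C ?\<phi>"
    unfolding smooth_chart_at_def using comp smooth graph e(1) by blast
  with e K(1) \<sigma>(1) L Ls Q\<sigma> pL Q\<sigma>L show ?thesis
    by (intro that[of e \<sigma> L])
qed

end

lemma dim_injective_image:
  fixes f :: "'a::real_vector \<Rightarrow> 'b::real_vector"
  assumes "linear f" "subspace S" "inj_on f S"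
  shows "dim (f ` S) = dim S"
proof -
  obtain B where B: "B \<subseteq> S" "independent B" "S \<subseteq> span B" "card B = dim S"
    using basis_exists by blast
  have "span B = S" using B assms(2) by (meson span_minimal subset_antisym)
  then have "independent (f ` B)"
    using linear_independent_injective_image[OF assms(1) B(2)] assms(3) by simp
  moreover have "f ` S \<subseteq> span (f ` B)"
    using linear_span_image[OF assms(1), of B] \<open>span B = S\<close> by simp
  ultimately show ?thesis
    using B assms(3) by (intro dim_unique[of "f ` B"]) (auto simp: card_image inj_on_subset)
qed

section \<open>Deformation cocycles\<close>

context ideal_projection
begin

text \<open>
  These functionals transfer smoothness and velocity of a curve of maps into the quotient, which
  are tested on functionals, to the representatives of its values.
\<close>

lemma rep_evaluation_functional:
  fixes l :: "'g \<Rightarrow> real" and x :: 'g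
  assumes "linear l"
  shows "(\<lambda>f. l (rep (f x))) \<in> lin_maps (hom_space (subspace_module UNIV) Q) (subspace_module UNIV)"
proof -
  have "f x \<in> carrier Q" if "f \<in> carrier (hom_space (subspace_module UNIV) Q)"
    for f :: "'g \<Rightarrow> 'g set"
    using that by (auto simp: hom_space_sel lin_maps_def)
  then show ?thesis
    by (auto simp: lin_maps_def[of "hom_space _ _"] hom_space_sel(2,3) rep_add rep_smult
      linear_add[OF assms] linear_cmul[OF assms])
qed

text \<open>
  If \<open>P t\<close> is a curve of morphisms through the projection, its kernels \<open>W t\<close> are ideals. With
  \<open>W t\<close> the graph of \<open>\<phi> t\<close>, differentiating \<open>P t (u + \<phi> t u) = 0\<close> at \<open>0\<close> expresses the velocity of
  \<open>W\<close> as minus the restriction of the velocity \<open>\<psi>\<close> of \<open>P\<close> to the ideal.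
\<close>

lemma Pi_map_deformation_cocycle:
  assumes "finite_basis (B :: 'g set)" and "\<psi> \<in> morphism_deformation_cocycles br I"
  shows "Pi_map I 0 \<psi> \<in> ideal_deformation_cocycles br I"
proof -
  interpret finite_basis B by fact
  obtain a b P where ab: "a < 0" "0 < b" and \<psi>: "\<psi> \<in> carrier (cochains 1 Q)"
    and P_smooth: "smooth_curve_on (hom_space (subspace_module UNIV) Q) {a<..<b} P"
    and P_hom: "\<And>t x y. t \<in> {a<..<b} \<Longrightarrow> P t (br x y) = quot_bracket br I (P t x) (P t y)"
    and P_0: "P 0 = quot_proj I"
    and P_vel: "has_velocity (hom_space (subspace_module UNIV) Q) P (\<lambda>x. \<psi> [x]) 0"
    using assms(2) unfolding morphism_deformation_cocycles_def by blast
  let ?J = "{a<..<b}"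
  define R where "R t x = rep (P t x)" for t x
  have P_lin: "P t \<in> lin_maps (subspace_module UNIV) Q" if "t \<in> ?J" for t
    using P_smooth that by (auto simp: smooth_curve_on_def hom_space_sel)
  then have P_carrier: "P t x \<in> carrier Q" if "t \<in> ?J" for t x
    using P_lin[OF that] by (auto simp: lin_maps_def)
  have R: "smooth_endo_on ?J R"
    unfolding smooth_endo_on_def smooth_vec_on_def
  proof (intro conjI ballI allI impI)
    fix t assume "t \<in> ?J"
    from P_lin[OF this] show "linear (R t)"
      unfolding R_def lin_maps_Q_iff[OF subspace_UNIV] linear_iff by simp
  next
    fix x and l :: "'g \<Rightarrow> real" assume "linear l"
    from P_smooth[unfolded smooth_curve_on_def, THEN conjunct2, rule_format,
        OF rep_evaluation_functional[OF this, of x]]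
    show "smooth_real_on ?J (\<lambda>t. l (R t x))"
      unfolding R_def .
  qed
  have pR: "p (R t x) = R t x" if "t \<in> ?J" for t x
    using P_carrier[OF that] by (simp add: R_def p_rep)
  have R0: "R 0 x = p x" for x by (simp add: R_def P_0)
  have J0: "open ?J" "0 \<in> ?J" using ab by auto
  let ?W = "\<lambda>t. {x. R t x = 0}"
  have W0: "?W 0 = I" by (simp add: R0 p_eq_0_iff)
  have "\<exists>y. R 0 y = p x" for x by (auto simp: R0)
  then obtain e \<sigma> L where e: "e > 0" "{0 - e<..<0 + e} \<subseteq> ?J" and \<sigma>: "linear \<sigma>"
    and L: "smooth_endo_on {0 - e<..<0 + e} L" "\<And>x. L 0 x = x"
    and R0\<sigma>: "\<And>x. R 0 (\<sigma> (p x)) = p x"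
    and pL: "\<And>t x. t \<in> {0 - e<..<0 + e} \<Longrightarrow> p (L t (p x)) = L t (p x)"
    and R\<sigma>L: "\<And>t x. t \<in> {0 - e<..<0 + e} \<Longrightarrow> R t (\<sigma> (L t (p x))) = p x"
    and chart: "smooth_chart_at ?W 0 (\<sigma> ` range p) (\<lambda>t. \<lambda>u\<in>?W 0. - \<sigma> (L t (R t u)))"
    using kernel_chart[OF J0 R linear_p p_idem pR] by blast
  let ?K = "{0 - e<..<0 + e}"
  let ?C = "\<sigma> ` range p"
  let ?\<phi> = "\<lambda>t. \<lambda>u\<in>?W 0. - \<sigma> (L t (R t u))"
  let ?v = "\<lambda>u\<in>?W 0. - \<sigma> (rep (\<psi> [u]))"
  have linR: "linear (R t)" if "t \<in> ?K" for t
    using smooth_endoD(2)[OF R] e that by blast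
  have linL: "linear (L t)" if "t \<in> ?K" for t
    using smooth_endoD(2)[OF L(1) that] .
  have p\<sigma>: "p (\<sigma> (p x)) = p x" for x
    using R0\<sigma> by (simp add: R0)
  have sub_W: "subspace (?W t)" if "t \<in> ?K" for t
    using linR[OF that] by (simp add: subspace_def linear_0 linear_add linear_cmul)
  have sub_C: "subspace ?C"
    by (intro linear_subspace_image \<sigma> linear_p subspace_UNIV)
  obtain e' where e': "e' > 0"
    and \<phi>_smooth: "smooth_curve_on (hom_space (subspace_module (?W 0)) (subspace_module ?C))
      {0 - e'<..<0 + e'} ?\<phi>"
    and graph: "\<And>t. t \<in> {0 - e'<..<0 + e'} \<Longrightarrow> ?W t = {u + ?\<phi> t u |u. u \<in> ?W 0}"
    using chart unfolding smooth_chart_at_def by blast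
  define d where "d = min e e'"
  let ?D = "{- d<..<d}"
  have d: "d > 0" "?D \<subseteq> ?K" "?D \<subseteq> {0 - e'<..<0 + e'}"
    using e(1) e' by (auto simp: d_def)
  have D_J: "?D \<subseteq> ?J"
    using d(2) e(2) by (rule order.trans)
  have dim_W: "dim (?W t) = dim I" if t: "t \<in> ?D" for t
  proof -
    \<comment> \<open>As \<open>W t\<close> is a graph over \<open>I\<close>, the map \<open>u \<mapsto> u + \<phi> t u\<close> is an isomorphism from \<open>I\<close> to \<open>W t\<close>.\<close>
    let ?g = "\<lambda>u. u + - \<sigma> (L t (R t u))"
    have tK: "t \<in> ?K" using t d by blast
    have "linear (\<lambda>u. - \<sigma> (L t (R t u)))"
      using linR[OF tK] linL[OF tK] \<sigma> by (intro linearI) (auto simp: linear_add linear_cmul)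
    then have g: "linear ?g"
      by (intro linear_compose_add linear_ident)
    have "?W t = ?g ` I"
      using graph[of t] t d(3) unfolding W0 by (auto simp: subset_iff)
    moreover have "inj_on ?g I"
    proof (subst linear_inj_on_iff_eq_0[OF g subspace_I], intro ballI impI)
      fix u assume u: "u \<in> I" "?g u = 0"
      define y where "y = L t (R t u)"
      have y: "p y = y"
        using pL[OF tK, of "R t u"] pR[OF subsetD[OF e(2) tK]] by (simp add: y_def)
      have "u = \<sigma> y" using u by (simp add: y_def)
      then have "y = 0"
        using u(1) p\<sigma>[of y] by (simp add: y flip: p_eq_0_iff)
      then show "u = 0"
        using \<open>u = \<sigma> y\<close> linear_0[OF \<sigma>] by simp
    qed
    ultimately show ?thesis
      using dim_injective_image[OF g subspace_I] by simp
  qed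
  have ideal_W: "lie_ideal br (?W t)" if t: "t \<in> ?D" for t
    unfolding lie_ideal_def
  proof (intro conjI allI ballI)
    show "subspace (?W t)" using sub_W t d by blast
    have tJ: "t \<in> ?J" using t D_J by blast
    fix x u assume "u \<in> ?W t"
    then have "P t u = quot_proj I 0"
      using quot_proj_rep[OF P_carrier[OF tJ], of u] by (simp add: R_def)
    moreover obtain z where "P t x = quot_proj I z"
      using P_carrier[OF tJ, of x] unfolding carrier_Q by blast
    ultimately have "R t (br x u) = p (br z 0)"
      by (simp add: P_hom[OF tJ] quot_bracket_quot_proj R_def)
    then show "br x u \<in> ?W t"
      using br_ideal[OF subspace_0[OF subspace_I]] p_eq_0_iff by simp
  qed
  have "smooth_Gr_curve_on (dim I) ?D ?W"
    unfolding smooth_Gr_curve_on_def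
  proof (intro conjI ballI)
    fix t assume t: "t \<in> ?D"
    then show "?W t \<in> Gr (dim I)"
      using sub_W dim_W d unfolding Gr_def by blast
    have tK: "t \<in> ?K" "t \<in> ?J" using t d D_J by blast+
    have "\<exists>y. R t y = p x" for x
      using R\<sigma>L[OF tK(1), of x] by blast
    then show "\<exists>C \<phi>. smooth_chart_at ?W t C \<phi>"
      using kernel_chart[OF J0(1) tK(2) R linear_p p_idem pR] by metis
  qed
  moreover have "has_Gr_velocity ?W (Pi_map I 0 \<psi> []) 0"
  proof -
    have \<psi>_lin: "linear (\<lambda>u. rep (\<psi> [u]))" and \<psi>_carrier: "\<psi> [u] \<in> carrier Q" for u
    proof -
      have "linear (\<lambda>u. rep (\<psi> ([0][0 := u])))"
        using \<psi> unfolding carrier_cochains_Q alternating_map_def by (metis length_Cons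
          list.size(3) One_nat_def zero_less_one)
      then show "linear (\<lambda>u. rep (\<psi> [u]))" by simp
      show "\<psi> [u] \<in> carrier Q" using cochain_apply[OF \<psi>, of "[u]"] by simp
    qed
    have "has_velocity (hom_space (subspace_module (?W 0)) (subspace_module ?C)) ?\<phi> ?v 0"
    proof (rule has_velocity_homI[OF _ sub_C, where J = "{0 - e'<..<0 + e'}"])
      show "subspace (?W 0)" using sub_W e by simp
      show "?\<phi> t \<in> carrier (hom_space (subspace_module (?W 0)) (subspace_module ?C))"
        if "t \<in> {0 - e'<..<0 + e'}" for t
        using \<phi>_smooth that unfolding smooth_curve_on_def by blast
      have "- \<sigma> (rep (\<psi> [u])) \<in> ?C" for u
        using p_rep[OF \<psi>_carrier, of u] subspace_neg[OF sub_C] by (metis imageI rangeI)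
      moreover have "linear (\<lambda>u. - \<sigma> (rep (\<psi> [u])))"
        using \<psi>_lin \<sigma> by (intro linearI) (simp_all add: linear_add[OF \<psi>_lin] linear_cmul[OF \<psi>_lin]
          linear_add linear_cmul)
      ultimately show "?v \<in> carrier (hom_space (subspace_module (?W 0)) (subspace_module ?C))"
        using sub_W e by (intro linear_restrict_hom sub_C) auto
    next
      fix u and m :: "'g \<Rightarrow> real" assume u: "u \<in> ?W 0" and m: "linear m"
      have "((\<lambda>t. l (R t u)) has_real_derivative l (rep (\<psi> [u]))) (at 0)"
        if "linear l" for l :: "'g \<Rightarrow> real"
        using P_vel[unfolded has_velocity_def, THEN conjunct2, rule_format,
            OF rep_evaluation_functional[OF that, of u]] unfolding R_def .
      moreover have "linear (\<lambda>x. m (- \<sigma> x))"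
        using m \<sigma> by (intro linearI) (simp_all add: linear_add linear_cmul linear_diff linear_neg)
      moreover have "R 0 u = 0" using u by simp
      ultimately have "((\<lambda>t. m (- \<sigma> (L t (R t u))))
          has_real_derivative m (- \<sigma> (L 0 (rep (\<psi> [u]))))) (at 0)"
        using has_derivative_endo_apply_at_zero[OF L(1), of 0 "\<lambda>t. R t u" "rep (\<psi> [u])"
          "\<lambda>x. m (- \<sigma> x)"] e(1)
        by simp
      then show "((\<lambda>t. m (?\<phi> t u)) has_real_derivative m (?v u)) (at 0)"
        using u by (simp add: L(2))
    qed (use e' in auto)
    moreover have "Pi_map I 0 \<psi> [] = (\<lambda>u\<in>?W 0. quot_proj (?W 0) (?v u))"
      unfolding W0
    proof (rule ideal_hom_eqI)
      fix u assume u: "u \<in> I"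
      have "rep (Pi_map I 0 \<psi> [] u) = - rep (\<psi> [u])"
        using rep_Pi_map[of \<psi> 0 "[]" u] \<psi> u by simp
      also have "\<dots> = p (- \<sigma> (rep (\<psi> [u])))"
        using p\<sigma>[of "rep (\<psi> [u])"] by (simp add: p_rep[OF \<psi>_carrier])
      finally show "rep (Pi_map I 0 \<psi> [] u) =
          rep ((\<lambda>u\<in>I. quot_proj I ((\<lambda>u\<in>I. - \<sigma> (rep (\<psi> [u]))) u)) u)"
        using u by simp
    qed (use Pi_map_extensional(2)[of "[]" 0 \<psi>] Pi_map_apply_closed[of \<psi> 0 "[]"] \<psi> in auto)
    ultimately show ?thesis
      using chart unfolding has_Gr_velocity_def by blast
  qed
  moreover have "Pi_map I 0 \<psi> \<in> carrier (cochains 0 (ideal_hom I))"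
    using Pi_map_carrier[of \<psi> 0] \<psi> by simp
  ultimately have "- d < 0 \<and> 0 < d \<and> smooth_Gr_curve_on (dim I) ?D ?W \<and>
      (\<forall>t\<in>?D. lie_ideal br (?W t)) \<and> ?W 0 = I \<and> has_Gr_velocity ?W (Pi_map I 0 \<psi> []) 0"
    and "Pi_map I 0 \<psi> \<in> carrier (cochains 0 (ideal_hom I))"
    using d(1) ideal_W W0 by simp_all
  then show ?thesis
    unfolding ideal_deformation_cocycles_def by blast
qed

end

theorem proposition4p5:
  fixes br :: "'g::real_vector \<Rightarrow> 'g \<Rightarrow> 'g" and I :: "'g set"
  assumes "finite_dimensional TYPE('g)"
    and "lie_algebra br"
    and "lie_ideal br I"
  shows "cochain_map (morphism_complex br I) (ideal_complex br I) (Pi_map I) \<and>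
    (\<forall>\<psi>\<in>morphism_deformation_cocycles br I. Pi_map I 0 \<psi> \<in> ideal_deformation_cocycles br I)"
proof -
  have "subspace I"
    using assms(3) by (simp add: lie_ideal_def)
  then obtain q where q: "linear q" "\<And>x. q x \<in> I" "\<And>x. x \<in> I \<Longrightarrow> q x = x"
    using exists_projection_onto by blast
  interpret ideal_projection I "\<lambda>x. x - q x" br
  proof (intro ideal_projection.intro quotient_projection.intro ideal_projection_axioms.intro)
    show "linear (\<lambda>x. x - q x)"
      by (intro linear_compose_sub linear_ident q(1))
    show "x - q x - q (x - q x) = x - q x" for x
      by (simp add: linear_diff[OF q(1)] q(2,3))
    show "x - q x = 0 \<longleftrightarrow> x \<in> I" for x
      using q(2,3) by (metis eq_iff_diff_eq_0)
  qed (rule assms(2,3))+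
  obtain S :: "'g set" where S: "finite S" "span S = UNIV"
    using assms(1) unfolding finite_dimensional_def by blast
  obtain B where B: "B \<subseteq> S" "independent B" "S \<subseteq> span B"
    using maximal_independent_subset by blast
  have "span B = UNIV"
    using S(2) B(3) by (metis span_mono span_span top.extremum_uniqueI)
  then have "finite_basis B"
    using B S by (unfold_locales) (auto intro: finite_subset)
  then show ?thesis
    using cochain_map_Pi_map Pi_map_deformation_cocycle by blast
qed

end
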